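(* Assume PFA. Then every $(\omega_1,\omega_1)$-gap is weakly levelwise-inseparable.
   Context: For families $\mathcal{L},\mathcal{R}$ of subsets of $\omega$, $(\mathcal{L},\mathcal{R})$ is a pregap if $L\cap R$ is finite for all $L\in\mathcal{L},R\in\mathcal{R}$; $C\subseteq\omega$ separates it if $L\setminus C$ and $C\cap R$ are finite for all $L\in\mathcal{L},R\in\mathcal{R}$; it is a gap if it is a pregap and no $C$ separates it. An $(\omega_1,\omega_1)$-gap is a gap $(L_\alpha,R_\alpha)_{\alpha\in\omega_1}$ with both sequences $\subseteq^*$-increasing. It is levelwise-inseparable if $(L_{\alpha+1}\setminus L_\alpha,R_{\alpha+1}\setminus R_\alpha)_{\alpha\in\omega_1}$ is a gap, and weakly levelwise-inseparable if it has a subgap (an $(\omega_1,\omega_1)$-gap $(\mathcal{L}',\mathcal{R}')$ with $\mathcal{L}'\subseteq\mathcal{L},\mathcal{R}'\subseteq\mathcal{R}$) which is levelwise-inseparable. *)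

theory Defs
  imports Complex_Main "HOL-Library.Countable_Set_Type" "HOL-Library.Equipollence"
begin

section \<open>The ordinal \<open>\<omega>\<^sub>1\<close> as a well-ordered type\<close>

typedef omega1 = "Field (cardSuc natLeq)"
  using Field_cardSuc_not_empty[OF natLeq_Card_order] by blast

instantiation omega1 :: wellorder
begin

definition less_eq_omega1 :: "omega1 \<Rightarrow> omega1 \<Rightarrow> bool" where
  "x \<le> y \<longleftrightarrow> (Rep_omega1 x, Rep_omega1 y) \<in> cardSuc natLeq"

definition less_omega1 :: "omega1 \<Rightarrow> omega1 \<Rightarrow> bool" where
  "x < y \<longleftrightarrow> x \<le> y \<and> x \<noteq> (y :: omega1)"

instance
proof -
  let ?r = "cardSuc natLeq"
  have wo: "Well_order ?r"
    using cardSuc_Card_order[OF natLeq_Card_order] by (rule Card_order_wo_rel[unfolded wo_rel_def])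
  have refl: "refl_on (Field ?r) ?r" and trans: "trans ?r" and antisym: "antisym ?r"
    and total: "total_on (Field ?r) ?r" and wf: "wf (?r - Id)"
    using wo by (auto simp: well_order_on_def linear_order_on_def partial_order_on_def
        preorder_on_def)
  have le_refl: "x \<le> x" for x :: omega1
    using refl Rep_omega1[of x] by (auto simp: less_eq_omega1_def refl_on_def)
  have le_antisym: "x = y" if "x \<le> y" "y \<le> x" for x y :: omega1
    using that antisym unfolding less_eq_omega1_def by (metis antisymD Rep_omega1_inject)
  have le_trans: "x \<le> z" if "x \<le> y" "y \<le> z" for x y z :: omega1
    using that trans unfolding less_eq_omega1_def by (meson transD)
  have le_total: "x \<le> y \<or> y \<le> x" for x y :: omega1
    using total Rep_omega1[of x] Rep_omega1[of y] le_refl[of x]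
    unfolding total_on_def less_eq_omega1_def by (metis Rep_omega1_inject)
  have "wf (inv_image (?r - Id) Rep_omega1)"
    using wf by (rule wf_inv_image)
  then have induct: "P a" if "\<And>x. (\<And>y. y < x \<Longrightarrow> P y) \<Longrightarrow> P x" for P and a :: omega1
    using that
    by (rule wf_induct_rule) (auto simp: less_omega1_def less_eq_omega1_def Rep_omega1_inject)
  have less_iff: "x < y \<longleftrightarrow> x \<le> y \<and> \<not> y \<le> x" for x y :: omega1
    unfolding less_omega1_def using le_refl le_antisym by blast
  show "OFCLASS(omega1, wellorder_class)"
    by (intro_classes; (fact less_iff le_refl le_total | erule (1) le_trans le_antisym
          | rule induct, blast))
qed

end

lemma countable_omega1_lessThan:
  includes cardinal_syntax
  shows "countable {..<a :: omega1}"
proof -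
  let ?r = "cardSuc natLeq"
  have "Rep_omega1 ` {..<a} \<subseteq> underS ?r (Rep_omega1 a)"
    by (auto simp: underS_def less_omega1_def less_eq_omega1_def Rep_omega1_inject)
  moreover have "|underS ?r (Rep_omega1 a)| \<le>o natLeq"
    using card_of_underS[OF cardSuc_Card_order[OF natLeq_Card_order] Rep_omega1]
      cardSuc_ordLeq_ordLess[OF natLeq_Card_order card_of_Card_order] by blast
  ultimately have "countable (Rep_omega1 ` {..<a})"
    by (metis countable_card_le_natLeq countable_subset)
  then show ?thesis
    by (simp add: countable_image_inj_eq inj_on_def Rep_omega1_inject)
qed

lemma uncountable_omega1:
  includes cardinal_syntax
  shows "uncountable (UNIV :: omega1 set)"
proof
  let ?r = "cardSuc natLeq"
  assume "countable (UNIV :: omega1 set)"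
  then have "countable (range Rep_omega1)" by simp
  then have "|Field ?r| \<le>o natLeq"
    by (simp add: type_definition.Rep_range[OF type_definition_omega1] countable_card_le_natLeq)
  then have "|Field ?r| <o ?r"
    using cardSuc_ordLeq_ordLess[OF natLeq_Card_order card_of_Card_order] by blast
  then show False
    using card_of_Field_ordIso[OF cardSuc_Card_order[OF natLeq_Card_order]]
      not_ordLess_ordIso by blast
qed

definition succ1 :: "omega1 \<Rightarrow> omega1" where
  "succ1 \<alpha> = (LEAST \<beta>. \<alpha> < \<beta>)"

lemma less_succ1: "\<alpha> < succ1 \<alpha>"
proof -
  have "\<exists>\<beta>. \<alpha> < \<beta>"
  proof (rule ccontr)
    assume "\<nexists>\<beta>. \<alpha> < \<beta>"
    then have "UNIV = insert \<alpha> {..<\<alpha>}" by (auto simp: not_less order.order_iff_strict)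
    then show False
      using uncountable_omega1 countable_omega1_lessThan[of \<alpha>] by (metis countable_insert)
  qed
  then show ?thesis unfolding succ1_def by (rule LeastI_ex)
qed

lemma succ1_le_iff: "succ1 \<alpha> \<le> \<beta> \<longleftrightarrow> \<alpha> < \<beta>"
  using less_succ1[of \<alpha>] by (auto simp: succ1_def intro: Least_le)

section \<open>Gaps\<close>

definition pregap :: "nat set set \<Rightarrow> nat set set \<Rightarrow> bool" where
  "pregap \<L> \<R> \<longleftrightarrow> (\<forall>L\<in>\<L>. \<forall>R\<in>\<R>. finite (L \<inter> R))"

definition separates :: "nat set \<Rightarrow> nat set set \<Rightarrow> nat set set \<Rightarrow> bool" where
  "separates C \<L> \<R> \<longleftrightarrow> (\<forall>L\<in>\<L>. \<forall>R\<in>\<R>. finite (L - C) \<and> finite (C \<inter> R))"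

definition gap :: "nat set set \<Rightarrow> nat set set \<Rightarrow> bool" where
  "gap \<L> \<R> \<longleftrightarrow> pregap \<L> \<R> \<and> (\<nexists>C. separates C \<L> \<R>)"

definition almost_subset :: "nat set \<Rightarrow> nat set \<Rightarrow> bool"  (infix \<open>\<subseteq>\<^sup>*\<close> 50) where
  "A \<subseteq>\<^sup>* B \<longleftrightarrow> finite (A - B)"

definition almost_increasing :: "(omega1 \<Rightarrow> nat set) \<Rightarrow> bool" where
  "almost_increasing A \<longleftrightarrow> (\<forall>\<alpha> \<beta>. \<alpha> < \<beta> \<longrightarrow> A \<alpha> \<subseteq>\<^sup>* A \<beta>)"

definition omega1_gap :: "(omega1 \<Rightarrow> nat set) \<Rightarrow> (omega1 \<Rightarrow> nat set) \<Rightarrow> bool" where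
  "omega1_gap L R \<longleftrightarrow> gap (range L) (range R) \<and> almost_increasing L \<and> almost_increasing R"

definition levelwise_inseparable :: "(omega1 \<Rightarrow> nat set) \<Rightarrow> (omega1 \<Rightarrow> nat set) \<Rightarrow> bool" where
  "levelwise_inseparable L R \<longleftrightarrow>
     gap (range (\<lambda>\<alpha>. L (succ1 \<alpha>) - L \<alpha>)) (range (\<lambda>\<alpha>. R (succ1 \<alpha>) - R \<alpha>))"

definition subgap :: "(omega1 \<Rightarrow> nat set) \<Rightarrow> (omega1 \<Rightarrow> nat set) \<Rightarrow>
    (omega1 \<Rightarrow> nat set) \<Rightarrow> (omega1 \<Rightarrow> nat set) \<Rightarrow> bool" where
  "subgap L' R' L R \<longleftrightarrow> omega1_gap L' R' \<and> range L' \<subseteq> range L \<and> range R' \<subseteq> range R"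

definition weakly_levelwise_inseparable ::
    "(omega1 \<Rightarrow> nat set) \<Rightarrow> (omega1 \<Rightarrow> nat set) \<Rightarrow> bool" where
  "weakly_levelwise_inseparable L R \<longleftrightarrow>
     (\<exists>L' R'. subgap L' R' L R \<and> levelwise_inseparable L' R')"

section \<open>Proper forcing\<close>

text \<open>In a forcing notion \<open>(P, r)\<close>, \<open>(p, q) \<in> r\<close> means \<open>p \<le> q\<close>: \<open>p\<close> is the stronger condition.\<close>

definition forcing_notion :: "'a set \<Rightarrow> 'a rel \<Rightarrow> bool" where
  "forcing_notion P r \<longleftrightarrow> P \<noteq> {} \<and> preorder_on P r"

definition compatible_in :: "'a set \<Rightarrow> 'a rel \<Rightarrow> 'a \<Rightarrow> 'a \<Rightarrow> bool" where
  "compatible_in P r p q \<longleftrightarrow> (\<exists>s\<in>P. (s, p) \<in> r \<and> (s, q) \<in> r)"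

definition dense_in :: "'a set \<Rightarrow> 'a rel \<Rightarrow> 'a set \<Rightarrow> bool" where
  "dense_in P r D \<longleftrightarrow> D \<subseteq> P \<and> (\<forall>p\<in>P. \<exists>d\<in>D. (d, p) \<in> r)"

definition predense_below :: "'a set \<Rightarrow> 'a rel \<Rightarrow> 'a set \<Rightarrow> 'a \<Rightarrow> bool" where
  "predense_below P r A q \<longleftrightarrow> (\<forall>s\<in>P. (s, q) \<in> r \<longrightarrow> (\<exists>a\<in>A. compatible_in P r a s))"

definition filter_in :: "'a set \<Rightarrow> 'a rel \<Rightarrow> 'a set \<Rightarrow> bool" where
  "filter_in P r G \<longleftrightarrow> G \<subseteq> P \<and> G \<noteq> {} \<and>
     (\<forall>p\<in>G. \<forall>q\<in>P. (p, q) \<in> r \<longrightarrow> q \<in> G) \<and>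
     (\<forall>p\<in>G. \<forall>q\<in>G. \<exists>s\<in>G. (s, p) \<in> r \<and> (s, q) \<in> r)"

text \<open>\<open>\<C>\<close> is closed and unbounded in the set of countable subsets of \<open>X\<close>.\<close>

definition club_countable :: "'b set \<Rightarrow> 'b set set \<Rightarrow> bool" where
  "club_countable X \<C> \<longleftrightarrow>
     (\<forall>N\<in>\<C>. N \<subseteq> X \<and> countable N) \<and>
     (\<forall>N. N \<subseteq> X \<and> countable N \<longrightarrow> (\<exists>M\<in>\<C>. N \<subseteq> M)) \<and>
     (\<forall>N :: nat \<Rightarrow> 'b set. (\<forall>n. N n \<in> \<C> \<and> N n \<subseteq> N (Suc n)) \<longrightarrow> (\<Union>n. N n) \<in> \<C>)"

text \<open>
  A countable model \<open>N\<close> enters the definition of properness only through the conditions and the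
  subsets of \<open>P\<close> that it contains. Hence models are represented by their traces, the countable
  subsets of the disjoint union \<open>P <+> Pow P\<close>. That club many countable models
  \<open>N \<prec> H(\<theta>)\<close> have generic conditions below each of their conditions, for all large \<open>\<theta>\<close>,
  is thereby read as a statement about a club of countable subsets of \<open>P <+> Pow P\<close>;
  clubs of countable sets can be projected and lifted along \<open>P <+> Pow P \<subseteq> H(\<theta>)\<close>.
\<close>

definition generic_condition :: "'a set \<Rightarrow> 'a rel \<Rightarrow> ('a + 'a set) set \<Rightarrow> 'a \<Rightarrow> bool" where
  "generic_condition P r N q \<longleftrightarrow> q \<in> P \<and>
     (\<forall>D. Inr D \<in> N \<and> dense_in P r D \<longrightarrow> predense_below P r {d \<in> D. Inl d \<in> N} q)"

definition proper :: "'a set \<Rightarrow> 'a rel \<Rightarrow> bool" where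
  "proper P r \<longleftrightarrow> (\<exists>\<C>. club_countable (P <+> Pow P) \<C> \<and>
     (\<forall>N\<in>\<C>. \<forall>p\<in>P. Inl p \<in> N \<longrightarrow> (\<exists>q. (q, p) \<in> r \<and> generic_condition P r N q)))"

text \<open>
  The proper forcing axiom for forcing notions on subsets of the type \<open>'a\<close>. Since types cannot be
  quantified inside a formula, \<open>'a\<close> plays the role of an ambient universe and has to be large for
  the axiom to have content; the axiom for \<open>'a\<close> implies the one for every type that injects
  into \<open>'a\<close>.
\<close>

definition PFA :: "'a itself \<Rightarrow> bool" where
  "PFA (T :: 'a itself) \<longleftrightarrow>
     (\<forall>(P :: 'a set) r. forcing_notion P r \<and> proper P r \<longrightarrow>
        (\<forall>D :: omega1 \<Rightarrow> 'a set. (\<forall>\<alpha>. dense_in P r (D \<alpha>)) \<longrightarrow>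
           (\<exists>G. filter_in P r G \<and> (\<forall>\<alpha>. G \<inter> D \<alpha> \<noteq> {}))))"

end

theory Submission
  imports Defs
begin

text \<open>
  For \<open>\<alpha> < \<beta>\<close> consider the pair \<open>(L \<beta> - L \<alpha>, R \<beta> - R \<alpha>)\<close>, its parts made disjoint by a finite change,
  and let two pairs cross if the left part of one meets the right part of the other; this graph is
  open. It suffices to find an uncountable set \<open>H\<close> of pairwise crossing pairs such that always
  \<open>\<beta> < \<alpha>'\<close> or \<open>\<beta>' < \<alpha>\<close>: restricting the gap to the indices occurring in \<open>H\<close>, the members of \<open>H\<close> become
  consecutive levels, and an uncountable crossing family is not separated.

  Such an \<open>H\<close> comes from a form of the open colouring axiom. A countable family of cross-free sets
  cannot cover all pairs above a given ordinal, as otherwise the gap would be separated. Force with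
  triples consisting of a countable increasing set of pairs, countably many promises about the pairs
  to be added later, and a finite colouring of that set whose colour classes are crossing.
  The first two components amount to a \<open>\<sigma>\<close>-closed forcing, the last one to a ccc
  forcing over it. For properness, decide along a descending sequence in the model which coloured
  tuples can be added inside a dense set, and promise at the limit to avoid the cross-free sections of
  the closures of the families obtained. A tuple added later is then, coordinate by
  coordinate from the last one, crossed by a tuple from the model.
\<close>

section \<open>Proper forcing\<close>

lemma club_countable_image:
  assumes club: "club_countable X \<C>" and inj: "inj_on \<phi> X"
  shows "club_countable (\<phi> ` X) ((`) \<phi> ` \<C>)"
proof -
  note clubs = club[unfolded club_countable_def]
  have sub: "N \<subseteq> X" "countable N" if "N \<in> \<C>" for N
    using bspec[OF conjunct1[OF clubs] that] by (rule conjunct1, rule conjunct2)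
  have cofinal: "\<exists>M\<in>(`) \<phi> ` \<C>. N \<subseteq> M" if N: "N \<subseteq> \<phi> ` X" "countable N" for N
  proof -
    obtain N0 where "countable N0" "N0 \<subseteq> X" and N0: "N = \<phi> ` N0"
      using iffD1[OF countable_subset_image conjI[OF N(2,1)]] by blast
    then obtain M where "M \<in> \<C>" "N0 \<subseteq> M"
      using clubs[THEN conjunct2, THEN conjunct1, rule_format, of N0] by auto
    then show ?thesis unfolding N0 by (intro bexI[of _ "\<phi> ` M"]) auto
  qed
  have Union: "(\<Union>n. N n) \<in> (`) \<phi> ` \<C>"
    if N: "\<And>n. N n \<in> (`) \<phi> ` \<C>" and incr: "\<And>n. N n \<subseteq> N (Suc n)" for N :: "nat \<Rightarrow> _"
  proof -
    from N have "\<forall>n. \<exists>M. M \<in> \<C> \<and> N n = \<phi> ` M" by blast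
    then obtain M where M: "\<And>n. M n \<in> \<C>" and NM: "\<And>n. N n = \<phi> ` M n" by metis
    have "M n \<subseteq> M (Suc n)" for n
    proof
      fix x assume "x \<in> M n"
      then have "\<phi> x \<in> \<phi> ` M (Suc n)" using incr[of n] unfolding NM by auto
      then show "x \<in> M (Suc n)"
        using inj_on_image_mem_iff[OF inj _ sub(1)[OF M]] sub(1)[OF M[of n]] \<open>x \<in> M n\<close> by blast
    qed
    then have "(\<Union>n. M n) \<in> \<C>"
      using clubs[THEN conjunct2, THEN conjunct2, rule_format, of M] M by simp
    moreover have "(\<Union>n. N n) = \<phi> ` (\<Union>n. M n)" using NM by auto
    ultimately show ?thesis by simp
  qed
  show ?thesis
    unfolding club_countable_def
  proof (intro conjI allI impI ballI)
    fix N assume "N \<in> (`) \<phi> ` \<C>"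
    then obtain M where "M \<in> \<C>" "N = \<phi> ` M" by blast
    then show "N \<subseteq> \<phi> ` X" "countable N" using sub[of M] by auto
  qed (use cofinal Union in auto)
qed

text \<open>A forcing notion on \<open>'b\<close> is copied to \<open>'u\<close> along
  \<open>h\<close>; properness and density pass to the copy, and the filter obtained there is pulled
  back. This lets the axiom for one large type serve the type of conditions.\<close>

lemma PFA_inj:
  fixes h :: "'b \<Rightarrow> 'u"
  assumes h: "inj h" and PFA: "PFA TYPE('u)"
  shows "PFA TYPE('b)"
  unfolding PFA_def
proof (intro allI impI, elim conjE)
  fix P :: "'b set" and r and D :: "omega1 \<Rightarrow> 'b set"
  assume forc: "forcing_notion P r" and proper: "proper P r" and dense: "\<forall>\<alpha>. dense_in P r (D \<alpha>)"
  define P' where "P' = h ` P"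
  define r' where "r' = map_prod h h ` r"
  have r'_iff [simp]: "(h a, h b) \<in> r' \<longleftrightarrow> (a, b) \<in> r" for a b
    unfolding r'_def using h by (auto simp: inj_eq)
  have P'_iff [simp]: "h a \<in> P' \<longleftrightarrow> a \<in> P" for a
    unfolding P'_def using h by (auto simp: inj_eq)
  have r: "r \<subseteq> P \<times> P" "refl_on P r" "trans r"
    using forc unfolding forcing_notion_def preorder_on_def by auto
  have forc': "forcing_notion P' r'"
    unfolding forcing_notion_def preorder_on_def
  proof (intro conjI)
    show "P' \<noteq> {}" using forc unfolding forcing_notion_def P'_def by blast
    show "r' \<subseteq> P' \<times> P'" using r unfolding r'_def P'_def by auto
    show "refl_on P' r'" using r unfolding P'_def refl_on_def by auto
    show "trans r'"
    proof (rule transI)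
      fix x y z assume "(x, y) \<in> r'" "(y, z) \<in> r'"
      then obtain a b c where "x = h a" "y = h b" "z = h c" unfolding r'_def by auto
      then show "(x, z) \<in> r'" using \<open>(x, y) \<in> r'\<close> \<open>(y, z) \<in> r'\<close> r(3) by (auto dest: transD)
    qed
  qed
  have compat': "compatible_in P' r' (h a) (h b) \<longleftrightarrow> compatible_in P r a b" for a b
    unfolding compatible_in_def P'_def by auto
  have dense': "dense_in P' r' (h ` E) \<longleftrightarrow> dense_in P r E" for E
    unfolding dense_in_def P'_def using h by (auto simp: inj_image_subset_iff)
  \<comment> \<open>A trace has conditions on the left and sets of conditions on the right, so
    \<open>h\<close> acts pointwise on the former and by images on the latter.\<close>
  define \<phi> where "\<phi> = map_sum h ((`) h)"
  have inj\<phi>: "inj \<phi>"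
    unfolding \<phi>_def using h by (intro sum.inj_map injI) (simp_all add: inj_image_eq_iff inj_eq)
  have \<phi>_Plus: "\<phi> ` (P <+> Pow P) = P' <+> Pow P'"
  proof -
    have "Pow P' = (`) h ` Pow P" unfolding P'_def by (rule image_Pow_surj[symmetric]) simp
    then show ?thesis
      unfolding \<phi>_def Plus_def by (simp add: P'_def image_Un image_image)
  qed
  obtain \<C> where club: "club_countable (P <+> Pow P) \<C>"
    and gen: "\<And>N p. N \<in> \<C> \<Longrightarrow> p \<in> P \<Longrightarrow> Inl p \<in> N \<Longrightarrow> \<exists>q. (q, p) \<in> r \<and> generic_condition P r N q"
    using proper unfolding proper_def by blast
  have "proper P' r'"
    unfolding proper_def
  proof (intro exI[of _ "(`) \<phi> ` \<C>"] conjI ballI impI)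
    show "club_countable (P' <+> Pow P') ((`) \<phi> ` \<C>)"
      using club_countable_image[OF club inj_on_subset[OF inj\<phi>]] \<phi>_Plus by simp
    fix N' p' assume "N' \<in> (`) \<phi> ` \<C>" "p' \<in> P'" "Inl p' \<in> N'"
    then obtain N p where N: "N \<in> \<C>" "N' = \<phi> ` N" "p \<in> P" "p' = h p" unfolding P'_def by auto
    have Inl_iff: "Inl (h a) \<in> N' \<longleftrightarrow> Inl a \<in> N" for a
      using inj_image_mem_iff[OF inj\<phi>, of "Inl a" N] N(2) by (simp add: \<phi>_def)
    have Inr_iff: "Inr (h ` E) \<in> N' \<longleftrightarrow> Inr E \<in> N" for E
      using inj_image_mem_iff[OF inj\<phi>, of "Inr E" N] N(2) by (simp add: \<phi>_def)
    obtain q where q: "(q, p) \<in> r" "generic_condition P r N q"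
      using gen N \<open>Inl p' \<in> N'\<close> Inl_iff by blast
    have "generic_condition P' r' N' (h q)"
      unfolding generic_condition_def
    proof (intro conjI allI impI)
      show "h q \<in> P'" using q(2) unfolding generic_condition_def by simp
      fix E' assume E': "Inr E' \<in> N' \<and> dense_in P' r' E'"
      then obtain E where E: "E' = h ` E" unfolding dense_in_def P'_def by (metis subset_imageE)
      have "predense_below P r {d \<in> E. Inl d \<in> N} q"
        using q(2) E' unfolding generic_condition_def E Inr_iff dense' by blast
      then have below: "\<exists>a\<in>E. Inl a \<in> N \<and> compatible_in P r a s" if "s \<in> P" "(s, q) \<in> r" for s
        using that unfolding predense_below_def by blast
      show "predense_below P' r' {d \<in> E'. Inl d \<in> N'} (h q)"
        unfolding predense_below_def
      proof (intro ballI impI)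
        fix s' assume s': "s' \<in> P'" "(s', h q) \<in> r'"
        then obtain s where s: "s' = h s" unfolding P'_def by blast
        then obtain a where "a \<in> E" "Inl a \<in> N" "compatible_in P r a s" using below[of s] s' by auto
        then show "\<exists>a\<in>{d \<in> E'. Inl d \<in> N'}. compatible_in P' r' a s'"
          unfolding E s by (intro bexI[of _ "h a"]) (simp_all add: compat' Inl_iff)
      qed
    qed
    then show "\<exists>q. (q, p') \<in> r' \<and> generic_condition P' r' N' q"
      using q(1) N(4) by (intro exI[of _ "h q"]) simp
  qed
  moreover have "\<forall>\<alpha>. dense_in P' r' (h ` D \<alpha>)" using dense dense' by simp
  ultimately obtain G' where G': "filter_in P' r' G'" "\<And>\<alpha>. G' \<inter> h ` D \<alpha> \<noteq> {}"
    using PFA[unfolded PFA_def, rule_format, of P' r' "\<lambda>\<alpha>. h ` D \<alpha>"] forc' by blast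
  then obtain G where G: "G' = h ` G" unfolding filter_in_def P'_def by (metis subset_imageE)
  have filter: "G' \<subseteq> P'" "G' \<noteq> {}" "\<And>p q. p \<in> G' \<Longrightarrow> q \<in> P' \<Longrightarrow> (p, q) \<in> r' \<Longrightarrow> q \<in> G'"
    "\<And>p q. p \<in> G' \<Longrightarrow> q \<in> G' \<Longrightarrow> \<exists>s\<in>G'. (s, p) \<in> r' \<and> (s, q) \<in> r'"
    using G'(1) unfolding filter_in_def by blast+
  have G_iff: "h a \<in> G' \<longleftrightarrow> a \<in> G" for a
    unfolding G using h by (auto simp: inj_eq)
  have "filter_in P r G"
    unfolding filter_in_def
  proof (intro conjI ballI impI)
    show "G \<subseteq> P" using filter(1) unfolding G by auto
    show "G \<noteq> {}" using filter(2) unfolding G by simp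
    show "q \<in> G" if "p \<in> G" "q \<in> P" "(p, q) \<in> r" for p q
      using filter(3)[of "h p" "h q"] that by (simp add: G_iff)
    show "\<exists>s\<in>G. (s, p) \<in> r \<and> (s, q) \<in> r" if "p \<in> G" "q \<in> G" for p q
      using filter(4)[of "h p" "h q"] that G by (auto simp: G_iff)
  qed
  moreover have "G \<inter> D \<alpha> \<noteq> {}" for \<alpha>
    using G'(2)[of \<alpha>] h unfolding G by (auto simp: inj_eq)
  ultimately show "\<exists>G. filter_in P r G \<and> (\<forall>\<alpha>. G \<inter> D \<alpha> \<noteq> {})" by blast
qed

section \<open>Closing off under countable operations\<close>

text \<open>Closing off takes countably many rounds: any three elements of an increasing union lie
  in a common member of it. The three arguments allow for two conditions and one set of
  conditions.\<close>

lemma club_countable_closed: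
  fixes \<Psi> :: "'x \<Rightarrow> 'x \<Rightarrow> 'x \<Rightarrow> 'x set"
  assumes countable: "\<And>x y z. countable (\<Psi> x y z)" and sub: "\<And>x y z. \<Psi> x y z \<subseteq> X"
  shows "club_countable X {N. N \<subseteq> X \<and> countable N \<and> (\<forall>x\<in>N. \<forall>y\<in>N. \<forall>z\<in>N. \<Psi> x y z \<subseteq> N)}"
  unfolding club_countable_def
proof (intro conjI allI impI ballI)
  fix N assume N: "N \<subseteq> X \<and> countable N"
  define M where "M = rec_nat N (\<lambda>_ M. M \<union> (\<Union>x\<in>M. \<Union>y\<in>M. \<Union>z\<in>M. \<Psi> x y z))"
  have M0: "M 0 = N" and MS: "M (Suc n) = M n \<union> (\<Union>x\<in>M n. \<Union>y\<in>M n. \<Union>z\<in>M n. \<Psi> x y z)" for n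
    unfolding M_def by simp_all
  have M: "M n \<subseteq> X \<and> countable (M n)" for n
  proof (induction n)
    case (Suc n)
    then show ?case unfolding MS using sub by (auto simp: countable subset_iff)
  qed (use N M0 in simp)
  have mono: "M m \<subseteq> M n" if "m \<le> n" for m n
    by (rule lift_Suc_mono_le[OF _ that]) (auto simp: MS)
  have "\<Psi> x y z \<subseteq> (\<Union>n. M n)" if xyz: "x \<in> M i" "y \<in> M j" "z \<in> M k" for x y z i j k
  proof -
    have "M i \<subseteq> M (max i (max j k))" "M j \<subseteq> M (max i (max j k))" "M k \<subseteq> M (max i (max j k))"
      by (rule mono, simp add: le_max_iff_disj)+
    then have "{x, y, z} \<subseteq> M (max i (max j k))" using xyz by auto
    then have "\<Psi> x y z \<subseteq> M (Suc (max i (max j k)))" unfolding MS by blast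
    then show ?thesis by blast
  qed
  then have "\<forall>x\<in>\<Union>(range M). \<forall>y\<in>\<Union>(range M). \<forall>z\<in>\<Union>(range M). \<Psi> x y z \<subseteq> \<Union>(range M)" by auto
  moreover have "\<Union>(range M) \<subseteq> X" "countable (\<Union>(range M))" using M by auto
  moreover have "N \<subseteq> \<Union>(range M)" using M0 by auto
  ultimately show "\<exists>M\<in>{N. N \<subseteq> X \<and> countable N \<and> (\<forall>x\<in>N. \<forall>y\<in>N. \<forall>z\<in>N. \<Psi> x y z \<subseteq> N)}. N \<subseteq> M"
    by (intro bexI[of _ "\<Union>(range M)"] CollectI conjI)
next
  fix N :: "nat \<Rightarrow> 'x set"
  assume N: "\<forall>n. N n \<in> {N. N \<subseteq> X \<and> countable N \<and> (\<forall>x\<in>N. \<forall>y\<in>N. \<forall>z\<in>N. \<Psi> x y z \<subseteq> N)} \<and> N n \<subseteq> N (Suc n)"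
  have Suc: "N n \<subseteq> N (Suc n)" and NX: "N n \<subseteq> X" and Nc: "countable (N n)"
    and closed: "x \<in> N n \<Longrightarrow> y \<in> N n \<Longrightarrow> z \<in> N n \<Longrightarrow> \<Psi> x y z \<subseteq> N n" for n x y z
    using N by simp_all
  have mono: "N m \<subseteq> N n" if "m \<le> n" for m n
    by (rule lift_Suc_mono_le[of N, OF Suc that])
  have "\<Psi> x y z \<subseteq> \<Union>(range N)" if xyz: "x \<in> N i" "y \<in> N j" "z \<in> N k" for x y z i j k
  proof -
    have "N i \<subseteq> N (max i (max j k))" "N j \<subseteq> N (max i (max j k))" "N k \<subseteq> N (max i (max j k))"
      by (rule mono, simp add: le_max_iff_disj)+
    then have "\<Psi> x y z \<subseteq> N (max i (max j k))" using xyz by (intro closed) (rule subsetD, assumption+)+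
    then show ?thesis by auto
  qed
  then have "\<forall>x\<in>\<Union>(range N). \<forall>y\<in>\<Union>(range N). \<forall>z\<in>\<Union>(range N). \<Psi> x y z \<subseteq> \<Union>(range N)" by simp
  moreover have "\<Union>(range N) \<subseteq> X" using NX by blast
  moreover have "countable (\<Union>(range N))" using Nc by simp
  ultimately show "(\<Union>n. N n) \<in> {N. N \<subseteq> X \<and> countable N \<and> (\<forall>x\<in>N. \<forall>y\<in>N. \<forall>z\<in>N. \<Psi> x y z \<subseteq> N)}"
    by simp
qed (simp_all only: mem_Collect_eq)

text \<open>A maximal element is split off and appended at the end. Linearity is assumed on
  \<open>S\<close> only, since points of one condition are comparable while arbitrary points need
  not be.\<close>

lemma finite_sorted_wrt_list:
  assumes "finite S" "transp_on S R" "irreflp_on S R" "\<And>x y. x \<in> S \<Longrightarrow> y \<in> S \<Longrightarrow> x = y \<or> R x y \<or> R y x"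
  shows "\<exists>xs. set xs = S \<and> sorted_wrt R xs"
  using assms
proof (induction S rule: finite_psubset_induct)
  case (psubset S)
  show ?case
  proof (cases "S = {}")
    case False
    have asym: "asymp_on S R"
    proof (rule asymp_onI)
      fix x y assume xy: "x \<in> S" "y \<in> S" "R x y"
      show "\<not> R y x"
        using transp_onD[OF psubset.prems(1) xy(1,2,1) xy(3)] irreflp_onD[OF psubset.prems(2) xy(1)] by blast
    qed
    obtain m where m: "m \<in> S" "\<And>x. x \<in> S \<Longrightarrow> x \<noteq> m \<Longrightarrow> \<not> R m x"
      using Finite_Set.bex_max_element[OF psubset.hyps(1) asym psubset.prems(1) False] by blast
    have "S - {m} \<subset> S" using m(1) by auto
    then have "\<exists>xs. set xs = S - {m} \<and> sorted_wrt R xs"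
    proof (rule psubset.IH)
      show "transp_on (S - {m}) R" using psubset.prems(1) by (rule transp_on_subset) auto
      show "irreflp_on (S - {m}) R" using psubset.prems(2) by (rule irreflp_on_subset) auto
      show "x = y \<or> R x y \<or> R y x" if "x \<in> S - {m}" "y \<in> S - {m}" for x y
        using psubset.prems(3) that by simp
    qed
    then obtain xs where xs: "set xs = S - {m}" "sorted_wrt R xs" by blast
    have "R x m" if "x \<in> S - {m}" for x
      using m psubset.prems(3)[of x m] that by auto
    then have "set (xs @ [m]) = S \<and> sorted_wrt R (xs @ [m])"
      using xs m(1) by (auto simp: sorted_wrt_append)
    then show ?thesis by blast
  qed simp
qed

section \<open>Uncountable cliques in open graphs\<close>

type_synonym 'a cond = "'a set \<times> 'a list set set \<times> ('a \<times> nat) set"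

text \<open>The fibres of the maps \<open>res k\<close>, finer as \<open>k\<close> grows, act as a
  countable base of a topology in which the graph \<open>K\<close> is open. The assumption
  \<open>rich\<close> makes conditions extendible: a point can be placed above the old ones while
  honouring countably many promises.\<close>

locale rich_open_graph =
  fixes X :: "'a set"
    and lt :: "'a \<Rightarrow> 'a \<Rightarrow> bool"  (infix \<open>\<lhd>\<close> 50)
    and K :: "'a \<Rightarrow> 'a \<Rightarrow> bool"
    and res :: "nat \<Rightarrow> 'a \<Rightarrow> 'c::countable"
  assumes lt_trans: "x \<lhd> y \<Longrightarrow> y \<lhd> z \<Longrightarrow> x \<lhd> z"
    and lt_irrefl: "\<not> x \<lhd> x"
    and K_sym: "K x y \<Longrightarrow> K y x"
    and res_mono: "k \<le> l \<Longrightarrow> res l x = res l y \<Longrightarrow> res k x = res k y"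
    and K_open: "K x y \<Longrightarrow> \<exists>k. \<forall>x' y'. res k x' = res k x \<longrightarrow> res k y' = res k y \<longrightarrow> K x' y'"
    and rich: "countable Y \<Longrightarrow> Y \<subseteq> X \<Longrightarrow> countable \<H> \<Longrightarrow> (\<And>H x y. H \<in> \<H> \<Longrightarrow> x \<in> H \<Longrightarrow> y \<in> H \<Longrightarrow> \<not> K x y)
      \<Longrightarrow> \<exists>x\<in>X. (\<forall>y\<in>Y. y \<lhd> x) \<and> x \<notin> \<Union>\<H>"
begin

lemma map_res_mono: "k \<le> l \<Longrightarrow> map (res l) xs = map (res l) ys \<Longrightarrow> map (res k) xs = map (res k) ys"
  by (auto simp: list_eq_iff_nth_eq intro: res_mono dest: map_eq_imp_length_eq)

lemma K_open_finite:
  assumes "finite S"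
  shows "\<exists>k. \<forall>x\<in>S. \<forall>y\<in>S. K x y \<longrightarrow> (\<forall>x'. res k x' = res k x \<longrightarrow> K x' y)"
proof -
  have "\<exists>k. \<forall>x'. K x y \<longrightarrow> res k x' = res k x \<longrightarrow> K x' y" for x y
    using K_open[of x y] by blast
  then obtain k where k: "\<And>x y x'. K x y \<Longrightarrow> res (k x y) x' = res (k x y) x \<Longrightarrow> K x' y" by metis
  define m where "m = Max ((\<lambda>(x, y). k x y) ` (S \<times> S))"
  have "k x y \<le> m" if "x \<in> S" "y \<in> S" for x y
    unfolding m_def using assms that by (intro Max_ge) force+
  then show ?thesis using k res_mono by (intro exI[of _ m]) blast
qed

section \<open>Closures of families of tuples\<close>

definition matches :: "'a list \<Rightarrow> (nat \<times> 'c) list \<Rightarrow> bool" where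
  "matches v \<tau> \<longleftrightarrow> list_all2 (\<lambda>y (k, c). res k y = c) v \<tau>"

text \<open>
  \<open>near \<F> \<tau>\<close> is the closure of the set of initial segments of those members of \<open>\<F>\<close> whose remaining
  entries lie in the basic open sets listed in \<open>\<tau>\<close>.
\<close>

definition near :: "'a list set \<Rightarrow> (nat \<times> 'c) list \<Rightarrow> 'a list set" where
  "near \<F> \<tau> = {w. \<forall>m. \<exists>w' v. map (res m) w' = map (res m) w \<and> w' @ v \<in> \<F> \<and> matches v \<tau>}"

text \<open>Keeping only last entries without a neighbour in their section makes every section
  edge-free, so this set may serve as a promise. A member of \<open>near\<close> outside it has a
  neighbour in its section.\<close>

definition isolated :: "'a list set \<Rightarrow> (nat \<times> 'c) list \<Rightarrow> 'a list set" where
  "isolated \<F> \<tau> = {w @ [z] |w z. w @ [z] \<in> near \<F> \<tau> \<and> (\<forall>z'. w @ [z'] \<in> near \<F> \<tau> \<longrightarrow> \<not> K z z')}"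

lemma isolated_section: "w @ [x] \<in> isolated \<F> \<tau> \<Longrightarrow> w @ [y] \<in> isolated \<F> \<tau> \<Longrightarrow> \<not> K x y"
  unfolding isolated_def by auto

text \<open>The entries of \<open>s\<close> are treated from the last one backwards. As
  \<open>x\<close> is not isolated, its section contains some \<open>z\<close> adjacent to
  \<open>x\<close>; by openness a basic neighbourhood of \<open>z\<close> consists of neighbours of
  \<open>x\<close>, and it is put in front of \<open>\<tau>\<close>. Once \<open>s\<close> is used
  up, any member of \<open>\<F>\<close> matching \<open>\<tau>\<close> is as required.\<close>

lemma near_adjacent:
  assumes "s \<in> near \<F> \<tau>" and "\<And>v. matches v \<tau> \<Longrightarrow> list_all2 K v u"
    and "\<And>w z r \<tau>. s = w @ [z] @ r \<Longrightarrow> w @ [z] \<notin> isolated \<F> \<tau>"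
  shows "\<exists>v\<in>\<F>. list_all2 K v (s @ u)"
  using assms
proof (induction s arbitrary: u \<tau> rule: rev_induct)
  case Nil
  then show ?case unfolding near_def by auto
next
  case (snoc x w)
  obtain z where z: "w @ [z] \<in> near \<F> \<tau>" "K x z"
    using snoc.prems(1) snoc.prems(3)[of w x "[]" \<tau>] unfolding isolated_def by auto
  obtain k where k: "\<And>y. res k y = res k z \<Longrightarrow> K y x"
    using K_open[OF z(2)] K_sym by blast
  have "w \<in> near \<F> ((k, res k z) # \<tau>)"
    unfolding near_def
  proof (intro CollectI allI)
    fix m
    \<comment> \<open>Precision \<open>max m k\<close> serves two ends: \<open>m\<close> keeps the
      first entries close to \<open>w\<close>, and \<open>k\<close> puts the entry near
      \<open>z\<close> into the neighbourhood just chosen.\<close>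
    obtain w' v where w': "map (res (max m k)) w' = map (res (max m k)) (w @ [z])" "w' @ v \<in> \<F>" "matches v \<tau>"
      using z(1) unfolding near_def by blast
    then obtain w1 z1 where w1: "w' = w1 @ [z1]" "map (res (max m k)) w1 = map (res (max m k)) w"
        "res (max m k) z1 = res (max m k) z"
      by (auto simp: map_eq_append_conv)
    have "map (res m) w1 = map (res m) w" "res k z1 = res k z"
      using w1 map_res_mono[of m "max m k" w1 w] res_mono[of k "max m k" z1 z] by auto
    then show "\<exists>w' v. map (res m) w' = map (res m) w \<and> w' @ v \<in> \<F> \<and> matches v ((k, res k z) # \<tau>)"
      using w'(2,3) w1(1) by (intro exI[of _ w1] exI[of _ "z1 # v"]) (auto simp: matches_def)
  qed
  moreover have "list_all2 K v (x # u)" if "matches v ((k, res k z) # \<tau>)" for v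
    using that snoc.prems(2) k unfolding matches_def by (auto simp: list_all2_Cons2)
  ultimately have "\<exists>v\<in>\<F>. list_all2 K v (w @ (x # u))"
    by (rule snoc.IH) (use snoc.prems(3) in auto)
  then show ?case by simp
qed

section \<open>The forcing notion\<close>

abbreviation points :: "'a cond \<Rightarrow> 'a set" where
  "points \<equiv> fst"

abbreviation promises :: "'a cond \<Rightarrow> 'a list set set" where
  "promises p \<equiv> fst (snd p)"

abbreviation colors :: "'a cond \<Rightarrow> ('a \<times> nat) set" where
  "colors p \<equiv> snd (snd p)"

text \<open>Only finitely many points are coloured, and a point may have several colours. Two
  colourings are therefore merged by taking their union, and only the edges within each colour have
  to be checked.\<close>

definition conds :: "'a cond set" where
  "conds = {p. points p \<subseteq> X \<and> countable (points p) \<and>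
     (\<forall>x\<in>points p. \<forall>y\<in>points p. x = y \<or> x \<lhd> y \<or> y \<lhd> x) \<and>
     countable (promises p) \<and> (\<forall>B\<in>promises p. \<forall>w x y. w @ [x] \<in> B \<longrightarrow> w @ [y] \<in> B \<longrightarrow> \<not> K x y) \<and>
     finite (colors p) \<and> colors p \<subseteq> points p \<times> UNIV \<and>
     (\<forall>x y c. (x, c) \<in> colors p \<longrightarrow> (y, c) \<in> colors p \<longrightarrow> x \<noteq> y \<longrightarrow> K x y)}"

text \<open>
  A promise is a set \<open>B\<close> of tuples; a new point must avoid every section of \<open>B\<close> given by earlier points,
  including those that are themselves new.
\<close>

definition extends (infix \<open>\<sqsubseteq>\<close> 50) where
  "p' \<sqsubseteq> p \<longleftrightarrow> points p \<subseteq> points p' \<and> promises p \<subseteq> promises p' \<and>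
     (\<forall>x\<in>points p' - points p. (\<forall>y\<in>points p. y \<lhd> x) \<and>
        (\<forall>B\<in>promises p. \<forall>w. set w \<subseteq> {y\<in>points p'. y \<lhd> x} \<longrightarrow> w @ [x] \<notin> B))"

text \<open>Colours are compared here and not in \<open>extends\<close>, so that a sequence
  descending for \<open>extends\<close> may change its colouring at every step.\<close>

definition cond_le where
  "cond_le = {(p', p). p' \<in> conds \<and> p \<in> conds \<and> p' \<sqsubseteq> p \<and> colors p \<subseteq> colors p'}"

lemma extends_refl: "p \<sqsubseteq> p"
  unfolding extends_def by auto

lemma extends_trans:
  assumes "p'' \<sqsubseteq> p'" "p' \<sqsubseteq> p"
  shows "p'' \<sqsubseteq> p"
  unfolding extends_def
proof (intro conjI ballI)
  show "points p \<subseteq> points p''" "promises p \<subseteq> promises p''"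
    using assms unfolding extends_def by auto
  fix x assume x: "x \<in> points p'' - points p"
  show "y \<lhd> x" if "y \<in> points p" for y
    using assms x that unfolding extends_def by (cases "x \<in> points p'") blast+
  show "\<forall>w. set w \<subseteq> {y\<in>points p''. y \<lhd> x} \<longrightarrow> w @ [x] \<notin> B" if B: "B \<in> promises p" for B
  proof (cases "x \<in> points p'")
    case True
    \<comment> \<open>Points entering after \<open>p'\<close> lie above all of
      \<open>points p'\<close>, so \<open>x\<close> gains no predecessors.\<close>
    then have "{y\<in>points p''. y \<lhd> x} \<subseteq> {y\<in>points p'. y \<lhd> x}"
      using assms(1) lt_trans lt_irrefl unfolding extends_def by blast
    then show ?thesis using assms(2) x True B unfolding extends_def by (meson DiffD2 DiffI order_trans)
  next
    case False
    then show ?thesis using assms x B unfolding extends_def by blast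
  qed
qed

lemma extends_chain_le:
  assumes "\<And>n. p (Suc n) \<sqsubseteq> p n" and "n \<le> m"
  shows "p m \<sqsubseteq> p n"
  using assms(2) by (induction rule: dec_induct) (use extends_refl extends_trans assms(1) in blast)+

text \<open>This is the \<open>\<sigma>\<close>-closure of the uncoloured part. A point is
  accompanied by all its predecessors as soon as it appears, so its promises can be checked at that
  stage. Further promises of \<open>q\<close> are harmless, as a promise binds only points added
  later.\<close>

lemma extends_chain:
  assumes chain: "\<And>n. p (Suc n) \<sqsubseteq> p n"
    and q: "points q = (\<Union>n. points (p n))" "(\<Union>n. promises (p n)) \<subseteq> promises q"
  shows "q \<sqsubseteq> p n"
proof -
  note le = extends_chain_le[of p, OF chain]
  show ?thesis
    unfolding extends_def
  proof (intro conjI ballI allI impI)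
    show "points (p n) \<subseteq> points q" using q by auto
    show "promises (p n) \<subseteq> promises q" using q(2) by blast
    fix x assume x: "x \<in> points q - points (p n)"
    then obtain m where m: "x \<in> points (p m)" using q by auto
    have "n \<le> m" using x m le[of m n] unfolding extends_def by (cases "n \<le> m") auto
    then have le': "p m \<sqsubseteq> p n" by (rule le)
    show "y \<lhd> x" if "y \<in> points (p n)" for y
      using le' x m that unfolding extends_def by auto
    fix B w assume B: "B \<in> promises (p n)" and w: "set w \<subseteq> {y\<in>points q. y \<lhd> x}"
    have "{y\<in>points q. y \<lhd> x} \<subseteq> {y\<in>points (p m). y \<lhd> x}"
    proof
      fix y assume y: "y \<in> {y\<in>points q. y \<lhd> x}"
      then obtain l where l: "y \<in> points (p l)" using q by auto
      have "y \<in> points (p m)"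
      proof (rule ccontr)
        assume "y \<notin> points (p m)"
        then have "p l \<sqsubseteq> p m" using l le[of l m] le[of m l] unfolding extends_def by (cases "l \<le> m") auto
        then have "x \<lhd> y" using \<open>y \<notin> points (p m)\<close> l m unfolding extends_def by blast
        then show False using y lt_trans lt_irrefl by blast
      qed
      then show "y \<in> {y\<in>points (p m). y \<lhd> x}" using y by simp
    qed
    then show "w @ [x] \<notin> B" using le' x m w B unfolding extends_def by (meson DiffD2 DiffI order_trans)
  qed
qed

lemma forcing_notion_conds: "forcing_notion conds cond_le"
  unfolding forcing_notion_def preorder_on_def
proof (intro conjI)
  have "({}, {}, {}) \<in> conds" unfolding conds_def by simp
  then show "conds \<noteq> {}" by blast
  show "cond_le \<subseteq> conds \<times> conds" unfolding cond_le_def by auto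
  show "refl_on conds cond_le" unfolding cond_le_def refl_on_def using extends_refl by auto
  show "trans cond_le" unfolding cond_le_def by (rule transI) (auto intro: extends_trans)
qed

section \<open>Properness\<close>

text \<open>\<open>C\<close> is a colour pattern on positions, so that the pattern of one tuple can
  be copied to another.\<close>

definition colored :: "'a list \<Rightarrow> (nat \<times> nat) set \<Rightarrow> ('a \<times> nat) set" where
  "colored t C = (\<lambda>(i, c). (t ! i, c)) ` C"

text \<open>The part \<open>G\<close> of the colouring is prescribed exactly, while the tuple
  carrying the pattern \<open>C\<close> is prescribed only up to precision \<open>k\<close>. Thus a
  tuple outside the model can be described by parameters available in it.\<close>

definition realizes where
  "realizes p D G C k \<sigma> p' \<longleftrightarrow> p' \<in> conds \<and> p' \<sqsubseteq> p \<and> p' \<in> D \<and>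
     (\<exists>t. map (res k) t = \<sigma> \<and> colors p' = G \<union> colored t C)"

definition realization where
  "realization p D G C k \<sigma> = (SOME p'. realizes p D G C k \<sigma> p')"

text \<open>This replaces elementarity: what can be realized with parameters from the model can be
  realized by a condition of the model. The condition \<open>p'\<close> ensures that the points
  mentioned in \<open>G\<close> come from the model.\<close>

definition closed_model where
  "closed_model N \<longleftrightarrow> N \<subseteq> conds <+> Pow conds \<and> countable N \<and>
     (\<forall>p p' D G C k \<sigma>. Inl p \<in> N \<longrightarrow> Inl p' \<in> N \<longrightarrow> Inr D \<in> N \<longrightarrow>
        G \<in> Fpow (points p' \<times> UNIV) \<longrightarrow> C \<in> Fpow UNIV \<longrightarrow> Ex (realizes p D G C k \<sigma>) \<longrightarrow>
        (\<exists>p''. Inl p'' \<in> N \<and> realizes p D G C k \<sigma> p''))"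

text \<open>For fixed \<open>p\<close>, \<open>p'\<close> and \<open>D\<close> there are only
  countably many \<open>G\<close>, \<open>C\<close>, \<open>k\<close> and \<open>\<sigma>\<close>,
  because \<open>points p'\<close> is countable. Choosing realizations is thus an operation with
  countable values, and the sets closed under it form a club.\<close>

lemma club_closed_model: "\<exists>\<C>. club_countable (conds <+> Pow conds) \<C> \<and> (\<forall>N\<in>\<C>. closed_model N)"
proof -
  define \<Psi> :: "_ \<Rightarrow> _ \<Rightarrow> _ \<Rightarrow> ('a cond + 'a cond set) set" where "\<Psi> u v w = {Inl (realization p D G C k \<sigma>) |p p' D G C k \<sigma>.
      u = Inl p \<and> v = Inl p' \<and> w = Inr D \<and> p' \<in> conds \<and> G \<in> Fpow (points p' \<times> UNIV) \<and>
      C \<in> Fpow UNIV \<and> Ex (realizes p D G C k \<sigma>)}"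
    for u v w :: "'a cond + 'a cond set"
  have real: "realizes p D G C k \<sigma> (realization p D G C k \<sigma>)" if "Ex (realizes p D G C k \<sigma>)" for p D G C k \<sigma>
    using that unfolding realization_def by (rule someI_ex)
  have "\<Psi> u v w \<subseteq> conds <+> Pow conds" for u v w
  proof
    fix z assume "z \<in> \<Psi> u v w"
    then obtain p D G C k \<sigma> where z: "z = Inl (realization p D G C k \<sigma>)" and ex: "Ex (realizes p D G C k \<sigma>)"
      unfolding \<Psi>_def by blast
    then show "z \<in> conds <+> Pow conds"
      using conjunct1[OF real[OF ex, unfolded realizes_def]] by (simp add: InlI)
  qed
  moreover have "countable (\<Psi> u v w)" for u v w
  proof -
    have "countable (\<Psi> (Inl p) (Inl p') (Inr D))" if "p' \<in> conds" for p p' D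
    proof (rule countable_subset)
      show "\<Psi> (Inl p) (Inl p') (Inr D) \<subseteq> (\<lambda>(G, C, k, \<sigma>). Inl (realization p D G C k \<sigma>)) `
          (Fpow (points p' \<times> UNIV) \<times> Fpow UNIV \<times> UNIV \<times> UNIV)"
        unfolding \<Psi>_def by (auto simp: image_iff split: prod.splits) blast
      have "countable (points p')" using that unfolding conds_def by auto
      then show "countable ((\<lambda>(G, C, k, \<sigma>). Inl (realization p D G C k \<sigma>)) `
          (Fpow (points p' \<times> UNIV) \<times> Fpow UNIV \<times> UNIV \<times> UNIV))"
        by (intro countable_image countable_SIGMA countable_Fpow) auto
    qed
    moreover have "\<Psi> u v w = {}" if "\<nexists>p p' D. u = Inl p \<and> v = Inl p' \<and> w = Inr D \<and> p' \<in> conds"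
      using that unfolding \<Psi>_def by blast
    ultimately show ?thesis by (metis countable_empty)
  qed
  ultimately have club: "club_countable (conds <+> Pow conds)
      {N. N \<subseteq> conds <+> Pow conds \<and> countable N \<and> (\<forall>x\<in>N. \<forall>y\<in>N. \<forall>z\<in>N. \<Psi> x y z \<subseteq> N)}"
    by (intro club_countable_closed)
  have closed: "closed_model N"
    if N: "N \<subseteq> conds <+> Pow conds" "countable N" "\<forall>x\<in>N. \<forall>y\<in>N. \<forall>z\<in>N. \<Psi> x y z \<subseteq> N" for N
    unfolding closed_model_def
  proof (intro conjI allI impI N(1,2))
    fix p p' D G C k \<sigma>
    assume *: "Inl p \<in> N" "Inl p' \<in> N" "Inr D \<in> N" "G \<in> Fpow (points p' \<times> UNIV)" "C \<in> Fpow UNIV"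
      "Ex (realizes p D G C k \<sigma>)"
    then have "Inl (realization p D G C k \<sigma>) \<in> \<Psi> (Inl p) (Inl p') (Inr D)"
      using N(1) unfolding \<Psi>_def by blast
    then show "\<exists>p''. Inl p'' \<in> N \<and> realizes p D G C k \<sigma> p''"
      using N(3) * real by blast
  qed
  show ?thesis
    by (rule exI, rule conjI, rule club) (use closed in simp)
qed

lemma conds_linear: "p \<in> conds \<Longrightarrow> x \<in> points p \<Longrightarrow> y \<in> points p \<Longrightarrow> x = y \<or> x \<lhd> y \<or> y \<lhd> x"
  unfolding conds_def by simp

lemma conds_points:
  assumes "p \<in> conds"
  shows "points p \<subseteq> X" "countable (points p)"
  using assms unfolding conds_def by simp_all

lemma conds_promises:
  assumes "p \<in> conds"
  shows "countable (promises p)" "B \<in> promises p \<Longrightarrow> w @ [x] \<in> B \<Longrightarrow> w @ [y] \<in> B \<Longrightarrow> \<not> K x y"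
proof -
  have "\<forall>B\<in>promises p. \<forall>w x y. w @ [x] \<in> B \<longrightarrow> w @ [y] \<in> B \<longrightarrow> \<not> K x y"
    using assms unfolding conds_def by simp
  then show "B \<in> promises p \<Longrightarrow> w @ [x] \<in> B \<Longrightarrow> w @ [y] \<in> B \<Longrightarrow> \<not> K x y" by blast
qed (use assms in \<open>simp add: conds_def\<close>)

lemma conds_colors:
  assumes "p \<in> conds"
  shows "finite (colors p)" "colors p \<subseteq> points p \<times> UNIV"
    "(x, c) \<in> colors p \<Longrightarrow> (y, c) \<in> colors p \<Longrightarrow> x \<noteq> y \<Longrightarrow> K x y"
  using assms unfolding conds_def by simp_all

text \<open>
  The tasks ask, along a descending sequence of conditions of the model, for a coloured tuple in a given
  basic open set that brings the condition into a given dense set. One attempt per task is enough,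
  as a failure is inherited by stronger conditions. The limit condition \<open>q\<close> need not lie in the
  model, so its promises may mention the families \<open>fam\<close> of tuples found on the way.
\<close>

lemma generic_below:
  assumes N: "closed_model N" and p0: "p0 \<in> conds" "Inl p0 \<in> N"
  shows "\<exists>q. (q, p0) \<in> cond_le \<and> generic_condition conds cond_le N q"
proof -
  define tasks :: "('a cond set \<times> ('a \<times> nat) set \<times> (nat \<times> nat) set \<times> nat \<times> 'c list) set" where
    "tasks = {(D, G, C, k, \<sigma>). Inr D \<in> N \<and> C \<in> Fpow UNIV \<and>
       (\<exists>p'. Inl p' \<in> N \<and> G \<in> Fpow (points p' \<times> UNIV))}"
  have N_conds: "p \<in> conds" if "Inl p \<in> N" for p
    using N that unfolding closed_model_def by auto
  have "countable N" using N unfolding closed_model_def by blast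
  have "countable (Inl -` N)" "countable (Inr -` N)"
  proof -
    have "Inl -` N \<subseteq> projl ` N" "Inr -` N \<subseteq> projr ` N" by force+
    then show "countable (Inl -` N)" "countable (Inr -` N)"
      using \<open>countable N\<close> by (meson countable_image countable_subset)+
  qed
  have countable_tasks: "countable tasks"
  proof (rule countable_subset)
    show "tasks \<subseteq> (Inr -` N) \<times> (\<Union>p'\<in>Inl -` N. Fpow (points p' \<times> UNIV)) \<times> Fpow UNIV \<times> UNIV \<times> UNIV"
      unfolding tasks_def by auto
    have "countable (points p)" if "Inl p \<in> N" for p
      using N_conds[OF that] by (rule conds_points)
    then have "countable (\<Union>p'\<in>Inl -` N. Fpow (points p' \<times> (UNIV :: nat set)))"
      using \<open>countable (Inl -` N)\<close> by (intro countable_UN countable_Fpow countable_SIGMA) auto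
    then show "countable ((Inr -` N) \<times> (\<Union>p'\<in>Inl -` N. Fpow (points p' \<times> (UNIV :: nat set))) \<times>
        Fpow (UNIV :: (nat \<times> nat) set) \<times> (UNIV :: nat set) \<times> (UNIV :: 'c list set))"
      using \<open>countable (Inr -` N)\<close> by (intro countable_SIGMA countable_Fpow) auto
  qed
  define handled where "handled p p' = (\<lambda>(D, G, C, k, \<sigma>).
      realizes p D G C k \<sigma> p' \<or> \<not> Ex (realizes p D G C k \<sigma>))" for p p'
  have step: "\<exists>p'. Inl p' \<in> N \<and> p' \<sqsubseteq> p \<and> (\<rho> \<in> tasks \<longrightarrow> handled p p' \<rho>)" if p: "Inl p \<in> N" for p \<rho>
  proof (cases "\<rho> \<in> tasks \<and> \<not> handled p p \<rho>")
    case True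
    obtain D G C k \<sigma> where \<rho>: "\<rho> = (D, G, C, k, \<sigma>)" by (cases \<rho>)
    have "Inr D \<in> N" "C \<in> Fpow UNIV" using True unfolding \<rho> tasks_def by auto
    moreover obtain p' where "Inl p' \<in> N" "G \<in> Fpow (points p' \<times> UNIV)"
      using True unfolding \<rho> tasks_def by auto
    moreover have "Ex (realizes p D G C k \<sigma>)" using True unfolding \<rho> handled_def by auto
    ultimately obtain p'' where "Inl p'' \<in> N" "realizes p D G C k \<sigma> p''"
      using N p unfolding closed_model_def by meson
    then have "p'' \<sqsubseteq> p" "handled p p'' \<rho>" unfolding \<rho> handled_def realizes_def by simp_all
    then show ?thesis using \<open>Inl p'' \<in> N\<close> by blast
  next
    case False
    then show ?thesis using p extends_refl by blast
  qed
  \<comment> \<open>Stage \<open>n\<close> handles the \<open>n\<close>-th task of an enumeration;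
    the membership guard covers the case that there are no tasks.\<close>
  have "\<exists>p. \<forall>n. (Inl (p n) \<in> N \<and> (n = 0 \<longrightarrow> p n = p0)) \<and>
      (p (Suc n) \<sqsubseteq> p n \<and> (from_nat_into tasks n \<in> tasks \<longrightarrow> handled (p n) (p (Suc n)) (from_nat_into tasks n)))"
  proof (rule dependent_nat_choice)
    show "\<exists>p. Inl p \<in> N \<and> (0 = (0::nat) \<longrightarrow> p = p0)" using p0(2) by blast
    fix p and n :: nat assume "Inl p \<in> N \<and> (n = 0 \<longrightarrow> p = p0)"
    then show "\<exists>p'. (Inl p' \<in> N \<and> (Suc n = 0 \<longrightarrow> p' = p0)) \<and>
        (p' \<sqsubseteq> p \<and> (from_nat_into tasks n \<in> tasks \<longrightarrow> handled p p' (from_nat_into tasks n)))"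
      using step by blast
  qed
  then obtain p where p: "\<And>n. (Inl (p n) \<in> N \<and> (n = 0 \<longrightarrow> p n = p0)) \<and>
      (p (Suc n) \<sqsubseteq> p n \<and> (from_nat_into tasks n \<in> tasks \<longrightarrow> handled (p n) (p (Suc n)) (from_nat_into tasks n)))"
    by blast
  then have pN: "Inl (p n) \<in> N" and "p 0 = p0" and chain: "p (Suc n) \<sqsubseteq> p n"
    and p_handled: "from_nat_into tasks n \<in> tasks \<Longrightarrow> handled (p n) (p (Suc n)) (from_nat_into tasks n)" for n
    by blast+
  have p_conds: "p n \<in> conds" for n using pN N_conds by blast
  have points_mono: "points (p n) \<subseteq> points (p m)" if "n \<le> m" for n m
    using extends_chain_le[of p, OF chain that] unfolding extends_def by blast
  define fam where "fam = (\<lambda>(D, G, C, k, \<sigma>).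
      {t. map (res k) t = \<sigma> \<and> (\<exists>n. p n \<in> D \<and> colors (p n) = G \<union> colored t C)})"
  define Y where "Y = (\<Union>n. points (p n))"
  \<comment> \<open>The sequence descends for \<open>extends\<close> only, so the limit keeps the
    colours of \<open>p0\<close>. The new promises are countably many, one for each task and each
    list of basic open sets.\<close>
  define q :: "'a cond" where
    "q = (Y, (\<Union>n. promises (p n)) \<union> (\<lambda>(\<rho>, \<tau>). isolated (fam \<rho>) \<tau>) ` (tasks \<times> UNIV), colors p0)"
  have q_extends: "q \<sqsubseteq> p n" for n
    by (rule extends_chain[of p, OF chain]) (auto simp: q_def Y_def)
  have "q \<in> conds"
  proof -
    have "Y \<subseteq> X" unfolding Y_def using conds_points(1)[OF p_conds] by blast
    moreover have "countable Y" unfolding Y_def using conds_points(2)[OF p_conds] by simp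
    moreover have "x = y \<or> x \<lhd> y \<or> y \<lhd> x" if xy: "x \<in> Y" "y \<in> Y" for x y
    proof -
      obtain n m where "x \<in> points (p n)" "y \<in> points (p m)" using xy unfolding Y_def by auto
      then have "x \<in> points (p (max n m))" "y \<in> points (p (max n m))"
        using points_mono[of n "max n m"] points_mono[of m "max n m"] by auto
      then show ?thesis using p_conds conds_linear by blast
    qed
    moreover have "countable (promises q)"
      using countable_tasks conds_promises(1)[OF p_conds] unfolding q_def by simp
    moreover have "\<not> K x y" if B: "B \<in> promises q" "w @ [x] \<in> B" "w @ [y] \<in> B" for B w x y
    proof (cases "\<exists>n. B \<in> promises (p n)")
      case True
      then show ?thesis using conds_promises(2)[OF p_conds] B(2,3) by blast
    next
      case False
      then show ?thesis using B isolated_section unfolding q_def by auto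
    qed
    moreover have "colors p0 \<subseteq> Y \<times> UNIV"
      using conds_colors(2)[OF p0(1)] \<open>p 0 = p0\<close> unfolding Y_def by blast
    ultimately show ?thesis
      using conds_colors(1,3)[OF p0(1)] unfolding conds_def by (simp add: q_def)
  qed
  have "(q, p0) \<in> cond_le"
    using \<open>q \<in> conds\<close> p0 q_extends[of 0] \<open>p 0 = p0\<close> unfolding cond_le_def by (simp add: q_def)
  moreover have "generic_condition conds cond_le N q"
    unfolding generic_condition_def
  proof (intro conjI allI impI)
    show "q \<in> conds" by fact
    fix D assume D: "Inr D \<in> N \<and> dense_in conds cond_le D"
    show "predense_below conds cond_le {d \<in> D. Inl d \<in> N} q"
      unfolding predense_below_def
    proof (intro ballI impI)
      fix s assume s: "s \<in> conds" "(s, q) \<in> cond_le"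
      \<comment> \<open>As \<open>r\<close> is below \<open>s\<close>, it suffices to find some
        \<open>p n\<close> in \<open>D\<close> that is compatible with \<open>r\<close>.\<close>
      obtain r where r: "r \<in> D" "(r, s) \<in> cond_le"
        using D s(1) unfolding dense_in_def by blast
      have "r \<in> conds" "r \<sqsubseteq> s" "colors s \<subseteq> colors r" "r \<sqsubseteq> q"
        using r(2) s(2) extends_trans unfolding cond_le_def by blast+
      have r_extends: "r \<sqsubseteq> p n" for n using extends_trans[OF \<open>r \<sqsubseteq> q\<close> q_extends] .
      \<comment> \<open>The set \<open>S\<close> defined next consists of the coloured points of
        \<open>r\<close> that are new over \<open>q\<close>, hence bound by the promises of
        \<open>q\<close>. Below, \<open>G\<close> is the old part of the colouring of
        \<open>r\<close>, and \<open>C\<close> is the pattern of the new part on the increasing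
        enumeration \<open>t\<close> of \<open>S\<close>.\<close>
      note r_colors = conds_colors[OF \<open>r \<in> conds\<close>]
      define S where "S = fst ` colors r - Y"
      have "S \<subseteq> points r" using r_colors(2) unfolding S_def by auto
      have "\<exists>t. set t = S \<and> sorted_wrt (\<lhd>) t"
      proof (rule finite_sorted_wrt_list)
        show "finite S" using r_colors(1) unfolding S_def by simp
        show "transp_on S (\<lhd>)" using lt_trans by (auto intro: transp_onI)
        show "irreflp_on S (\<lhd>)" using lt_irrefl by (auto intro: irreflp_onI)
        show "x = y \<or> x \<lhd> y \<or> y \<lhd> x" if "x \<in> S" "y \<in> S" for x y
          using that \<open>S \<subseteq> points r\<close> conds_linear[OF \<open>r \<in> conds\<close>] by blast
      qed
      then obtain t where t: "set t = S" "sorted_wrt (\<lhd>) t" by blast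
      have t_less: "t ! i \<lhd> t ! j" if "i < j" "j < length t" for i j
        using t(2) that by (simp add: sorted_wrt_iff_nth_less)
      have t_neq: "t ! i \<noteq> t ! j" if "i \<noteq> j" "i < length t" "j < length t" for i j
        using t_less[of i j] t_less[of j i] that lt_irrefl by (metis linorder_neqE_nat)
      define G where "G = colors r \<inter> (Y \<times> UNIV)"
      define C where "C = {(i, c). i < length t \<and> (t ! i, c) \<in> colors r}"
      have "finite G" using r_colors(1) unfolding G_def by simp
      have "finite C"
      proof (rule finite_subset)
        show "C \<subseteq> {..<length t} \<times> snd ` colors r" unfolding C_def by force
        show "finite ({..<length t} \<times> snd ` colors r)" using r_colors(1) by simp
      qed
      have colors_r: "colors r = G \<union> colored t C"
      proof
        show "colors r \<subseteq> G \<union> colored t C"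
        proof
          fix z assume z: "z \<in> colors r"
          obtain x c where xc: "z = (x, c)" by (cases z)
          show "z \<in> G \<union> colored t C"
          proof (cases "x \<in> Y")
            case False
            then have "x \<in> set t" using z xc t(1) unfolding S_def by force
            then obtain i where "i < length t" "t ! i = x" by (auto simp: in_set_conv_nth)
            then show ?thesis using z xc unfolding colored_def C_def by force
          qed (use z xc in \<open>simp add: G_def\<close>)
        qed
        show "G \<union> colored t C \<subseteq> colors r" unfolding G_def colored_def C_def by auto
      qed
      \<comment> \<open>At precision \<open>k\<close>, replacing one entry of \<open>t\<close>
        preserves its edges to the other entries.\<close>
      obtain k where k: "\<And>x y x'. x \<in> S \<Longrightarrow> y \<in> S \<Longrightarrow> K x y \<Longrightarrow> res k x' = res k x \<Longrightarrow> K x' y"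
        using K_open_finite[of S] t(1) by (metis finite_set)
      \<comment> \<open>As \<open>G\<close> is finite, its points all appear by a single stage,
        whose condition makes \<open>G\<close> an admissible parameter of a task.\<close>
      have "\<exists>n. G \<subseteq> points (p n) \<times> UNIV"
      proof -
        have "\<forall>z\<in>G. \<exists>n. fst z \<in> points (p n)" unfolding G_def Y_def by auto
        then obtain f where f: "\<And>z. z \<in> G \<Longrightarrow> fst z \<in> points (p (f z))" by metis
        have "fst z \<in> points (p (Max (f ` G)))" if "z \<in> G" for z
          using f[OF that] points_mono[of "f z" "Max (f ` G)"] \<open>finite G\<close> that by auto
        then show ?thesis by (intro exI[of _ "Max (f ` G)"]) force
      qed
      then obtain n where G_sub: "G \<subseteq> points (p n) \<times> UNIV" by blast
      have task: "(D, G, C, l, \<sigma>) \<in> tasks" for l \<sigma>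
        unfolding tasks_def mem_Collect_eq case_prod_conv
      proof (intro conjI exI[of _ "p n"])
        show "Inr D \<in> N" using D by simp
      qed (use \<open>finite G\<close> \<open>finite C\<close> G_sub pN in \<open>simp_all add: Fpow_def\<close>)
      define \<F> where "\<F> = fam (D, G, C, k, map (res k) t)"
      have "t \<in> near \<F> []"
        unfolding near_def
      proof (intro CollectI allI)
        fix m
        define l where "l = max m k"
        obtain n where n: "from_nat_into tasks n = (D, G, C, l, map (res l) t)"
          using from_nat_into_surj[OF countable_tasks task] by blast
        \<comment> \<open>The condition \<open>r\<close> itself shows that the task is realizable
          over \<open>p n\<close>. So stage \<open>n\<close> did realize it, by a tuple
          \<open>t'\<close> that agrees with \<open>t\<close> up to \<open>l\<close>; here
          \<open>k\<close> ensures membership in \<open>\<F>\<close> and \<open>m\<close> the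
          approximation.\<close>
        have "realizes (p n) D G C l (map (res l) t) r"
          unfolding realizes_def using \<open>r \<in> conds\<close> r_extends r(1) colors_r by blast
        then have "realizes (p n) D G C l (map (res l) t) (p (Suc n))"
          using p_handled[of n] task[of l "map (res l) t"] unfolding n handled_def case_prod_conv by blast
        then obtain t' where t': "map (res l) t' = map (res l) t" "colors (p (Suc n)) = G \<union> colored t' C"
            "p (Suc n) \<in> D"
          unfolding realizes_def by blast
        have "map (res k) t' = map (res k) t" "map (res m) t' = map (res m) t"
          using map_res_mono[OF _ t'(1)] unfolding l_def by auto
        then show "\<exists>w' v. map (res m) w' = map (res m) t \<and> w' @ v \<in> \<F> \<and> matches v []"
          using t'(2,3) unfolding \<F>_def fam_def
          by (intro exI[of _ t'] exI[of _ "[]"]) (auto simp: matches_def)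
      qed
      then have "\<exists>v\<in>\<F>. list_all2 K v (t @ [])"
      proof (rule near_adjacent)
        show "list_all2 K v []" if "matches v []" for v
          using that unfolding matches_def by simp
        fix w z rest \<tau> assume t_eq: "t = w @ [z] @ rest"
        have "isolated \<F> \<tau> \<in> promises q"
          using task unfolding q_def \<F>_def by auto
        moreover have "z \<in> points r - points q"
          using t(1) \<open>S \<subseteq> points r\<close> unfolding t_eq q_def S_def by auto
        moreover have "set w \<subseteq> {y \<in> points r. y \<lhd> z}"
          using t \<open>S \<subseteq> points r\<close> unfolding t_eq by (auto simp: sorted_wrt_append)
        ultimately show "w @ [z] \<notin> isolated \<F> \<tau>"
          using \<open>r \<sqsubseteq> q\<close> unfolding extends_def by blast
      qed
      then obtain v where "v \<in> \<F>" and v_adj: "list_all2 K v t" by auto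
      then obtain n where v_res: "map (res k) v = map (res k) t" and n: "p n \<in> D" "colors (p n) = G \<union> colored v C"
        unfolding \<F>_def fam_def by auto
      have len: "length v = length t" using v_adj by (rule list_all2_lengthD)
      \<comment> \<open>The common extension keeps the points and promises of \<open>r\<close> and
        adds only the colours of \<open>p n\<close>, whose points already belong to
        \<open>r\<close>.\<close>
      define e :: "'a cond" where "e = (points r, promises r, colors r \<union> colors (p n))"
      \<comment> \<open>If \<open>y\<close> has its colour from \<open>G\<close>, both points have
        this colour in \<open>p n\<close>. Otherwise they are entries of \<open>v\<close> and
        \<open>t\<close>: at equal positions they are adjacent by the choice of \<open>v\<close>, at
        different positions by openness.\<close>
      have K_new: "K x y" if xy: "(x, c) \<in> colored v C" "(y, c) \<in> colors r" "x \<noteq> y" for x y c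
      proof (cases "(y, c) \<in> G")
        case True
        then show ?thesis using xy n(2) conds_colors(3)[OF p_conds] by blast
      next
        case False
        then obtain i j where ij: "x = v ! i" "(i, c) \<in> C" "y = t ! j" "(j, c) \<in> C"
          using xy colors_r unfolding colored_def by auto
        then have ij_len: "i < length t" "j < length t" unfolding C_def by auto
        show ?thesis
        proof (cases "i = j")
          case True
          then show ?thesis using v_adj ij ij_len by (simp add: list_all2_conv_all_nth)
        next
          case False
          then have "K (t ! i) (t ! j)"
            using ij r_colors(3) t_neq[OF False ij_len] unfolding C_def by blast
          moreover have "res k (v ! i) = res k (t ! i)"
            using v_res ij_len len by (metis nth_map)
          ultimately show ?thesis using k t(1) ij ij_len by (metis nth_mem)
        qed
      qed
      have "e \<in> conds"
      proof -
        have colors_e: "colors e = colors r \<union> colored v C"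
          unfolding e_def n(2) colors_r by auto
        have "points (p n) \<subseteq> points r" using r_extends unfolding extends_def by blast
        then have "colors e \<subseteq> points e \<times> UNIV"
          using r_colors(2) conds_colors(2)[OF p_conds[of n]] unfolding e_def by auto
        moreover have "K x y" if "(x, c) \<in> colors e" "(y, c) \<in> colors e" "x \<noteq> y" for x y c
          using that K_new[of x c y] K_sym[OF K_new[of y c x]] r_colors(3)[of x c y]
            conds_colors(3)[OF p_conds[of n], of x c y] n(2)
          unfolding colors_e by blast
        moreover have "finite (colors e)"
          using r_colors(1) conds_colors(1)[OF p_conds[of n]] unfolding e_def by simp
        ultimately show ?thesis
          using conds_points[OF \<open>r \<in> conds\<close>] conds_promises[OF \<open>r \<in> conds\<close>] conds_linear[OF \<open>r \<in> conds\<close>]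
          unfolding conds_def by (simp add: e_def)
      qed
      have "e \<sqsubseteq> r" unfolding e_def extends_def by auto
      then have "(e, p n) \<in> cond_le" "(e, s) \<in> cond_le"
        using \<open>e \<in> conds\<close> p_conds s(1) extends_trans r_extends \<open>r \<sqsubseteq> s\<close> \<open>colors s \<subseteq> colors r\<close>
        unfolding cond_le_def by (auto simp: e_def)
      then show "\<exists>a\<in>{d \<in> D. Inl d \<in> N}. compatible_in conds cond_le a s"
        using n(1) pN \<open>e \<in> conds\<close> unfolding compatible_in_def by blast
    qed
  qed
  ultimately show ?thesis by blast
qed

lemma proper_conds: "proper conds cond_le"
  unfolding proper_def using club_closed_model generic_below by meson

section \<open>Cliques from a filter\<close>

text \<open>A filter meeting each \<open>D \<alpha>\<close> colours some point above
  \<open>y \<alpha>\<close>. Each colour class is a clique, because two of its points have their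
  colour in a common condition. With only countably many colours, one class works for uncountably
  many \<open>\<alpha>\<close>.\<close>

lemma uncountable_clique:
  assumes PFA: "PFA TYPE('a cond)" and y: "\<And>\<alpha>. y \<alpha> \<in> X"
  shows "\<exists>H\<subseteq>X. (\<forall>u\<in>H. \<forall>v\<in>H. u \<noteq> v \<longrightarrow> K u v \<and> (u \<lhd> v \<or> v \<lhd> u)) \<and>
    uncountable {\<alpha> :: omega1. \<exists>x\<in>H. y \<alpha> \<lhd> x}"
proof -
  define D where "D \<alpha> = {p\<in>conds. \<exists>x\<in>fst ` colors p. y \<alpha> \<lhd> x}" for \<alpha> :: omega1
  have dense: "dense_in conds cond_le (D \<alpha>)" for \<alpha>
    unfolding dense_in_def
  proof (intro conjI ballI)
    show "D \<alpha> \<subseteq> conds" unfolding D_def by auto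
    fix p assume p: "p \<in> conds"
    have "points p \<subseteq> X" "countable (points p)" "countable (promises p)"
      using p by (rule conds_points conds_promises)+
    note sections = conds_promises(2)[OF p]
    \<comment> \<open>These are the edge-free sections that a new point above all of
      \<open>points p\<close> has to avoid. There are countably many, since lists over a countable
      set are countable.\<close>
    define \<H> where "\<H> = (\<lambda>(B, w). {z. w @ [z] \<in> B}) ` (promises p \<times> lists (points p))"
    have "\<exists>x\<in>X. (\<forall>z\<in>insert (y \<alpha>) (points p). z \<lhd> x) \<and> x \<notin> \<Union>\<H>"
    proof (rule rich)
      show "countable (insert (y \<alpha>) (points p))" using \<open>countable (points p)\<close> by simp
      show "insert (y \<alpha>) (points p) \<subseteq> X" using y \<open>points p \<subseteq> X\<close> by simp
      show "countable \<H>"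
        unfolding \<H>_def using \<open>countable (points p)\<close> \<open>countable (promises p)\<close>
        by (intro countable_image countable_SIGMA countable_lists)
      show "\<not> K u v" if "H \<in> \<H>" "u \<in> H" "v \<in> H" for H u v
        using that sections unfolding \<H>_def by auto
    qed
    then obtain x where x: "x \<in> X" "y \<alpha> \<lhd> x" "\<And>z. z \<in> points p \<Longrightarrow> z \<lhd> x" "x \<notin> \<Union>\<H>" by auto
    obtain c where c: "c \<notin> snd ` colors p"
      using conds_colors(1)[OF p] by (metis ex_new_if_finite finite_imageI infinite_UNIV_nat)
    define q :: "'a cond" where "q = (insert x (points p), promises p, insert (x, c) (colors p))"
    have "q \<in> conds"
    proof -
      have "u = v \<or> u \<lhd> v \<or> v \<lhd> u" if "u \<in> points q" "v \<in> points q" for u v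
        using that x(3) conds_linear[OF p] unfolding q_def by auto
      moreover have "K u v" if "(u, d) \<in> colors q" "(v, d) \<in> colors q" "u \<noteq> v" for u v d
        using that c conds_colors(3)[OF p] unfolding q_def by (auto simp: image_iff)
      moreover have "points q \<subseteq> X" "countable (points q)" "colors q \<subseteq> points q \<times> UNIV" "finite (colors q)"
        using x(1) \<open>points p \<subseteq> X\<close> \<open>countable (points p)\<close> conds_colors(1,2)[OF p] unfolding q_def by auto
      ultimately show ?thesis
        using \<open>countable (promises p)\<close> sections unfolding conds_def by (simp add: q_def)
    qed
    moreover have "q \<sqsubseteq> p"
      unfolding extends_def
    proof (intro conjI ballI allI impI)
      fix x' z assume "x' \<in> points q - points p" "z \<in> points p"
      then show "z \<lhd> x'" using x(3) unfolding q_def by auto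
    next
      fix x' B w assume x': "x' \<in> points q - points p" and B: "B \<in> promises p"
        and w: "set w \<subseteq> {z \<in> points q. z \<lhd> x'}"
      have "x' = x" using x' unfolding q_def by auto
      then have "w \<in> lists (points p)" using w lt_irrefl unfolding q_def by auto
      then show "w @ [x'] \<notin> B" using x(4) B \<open>x' = x\<close> unfolding \<H>_def by auto
    qed (auto simp: q_def)
    ultimately have "(q, p) \<in> cond_le" using p unfolding cond_le_def by (auto simp: q_def)
    moreover have "q \<in> D \<alpha>" using \<open>q \<in> conds\<close> x(2) unfolding D_def q_def by auto
    ultimately show "\<exists>d\<in>D \<alpha>. (d, p) \<in> cond_le" by blast
  qed
  obtain \<G> where \<G>: "filter_in conds cond_le \<G>" "\<And>\<alpha>. \<G> \<inter> D \<alpha> \<noteq> {}"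
    using PFA[unfolded PFA_def, rule_format, of conds cond_le D] forcing_notion_conds proper_conds dense by auto
  define H where "H c = {x. \<exists>p\<in>\<G>. (x, c) \<in> colors p}" for c
  have "\<G> \<subseteq> conds" using \<G>(1) unfolding filter_in_def by blast
  have H: "u \<in> X" "u \<noteq> v \<Longrightarrow> K u v" "u \<noteq> v \<Longrightarrow> u \<lhd> v \<or> v \<lhd> u" if uv: "u \<in> H c" "v \<in> H c" for u v c
  proof -
    obtain p p' where "p \<in> \<G>" "p' \<in> \<G>" "(u, c) \<in> colors p" "(v, c) \<in> colors p'"
      using uv unfolding H_def by blast
    moreover obtain s where "s \<in> \<G>" "(s, p) \<in> cond_le" "(s, p') \<in> cond_le"
      using \<G>(1) calculation(1,2) unfolding filter_in_def by meson
    ultimately have s: "s \<in> conds" "(u, c) \<in> colors s" "(v, c) \<in> colors s"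
      unfolding cond_le_def by auto
    then have "u \<in> points s" "v \<in> points s" using conds_colors(2) by blast+
    then show "u \<in> X" "u \<noteq> v \<Longrightarrow> K u v" "u \<noteq> v \<Longrightarrow> u \<lhd> v \<or> v \<lhd> u"
      using s conds_linear[OF s(1)] conds_colors(3)[OF s(1)] conds_points(1)[OF s(1)] by blast+
  qed
  have "(\<Union>c. {\<alpha>. \<exists>x\<in>H c. y \<alpha> \<lhd> x}) = UNIV"
  proof -
    have "\<exists>c. \<exists>x\<in>H c. y \<alpha> \<lhd> x" for \<alpha>
    proof -
      obtain p x c where "p \<in> \<G>" "(x, c) \<in> colors p" "y \<alpha> \<lhd> x"
        using \<G>(2)[of \<alpha>] unfolding D_def by fastforce
      then show ?thesis unfolding H_def by blast
    qed
    then show ?thesis by blast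
  qed
  then have "\<not> (\<forall>c. countable {\<alpha>. \<exists>x\<in>H c. y \<alpha> \<lhd> x})"
    using uncountable_omega1 countable_UN[of UNIV "\<lambda>c. {\<alpha>. \<exists>x\<in>H c. y \<alpha> \<lhd> x}"] by auto
  then obtain c where "uncountable {\<alpha>. \<exists>x\<in>H c. y \<alpha> \<lhd> x}" by blast
  moreover have "H c \<subseteq> X" using H(1) by blast
  moreover have "\<forall>u\<in>H c. \<forall>v\<in>H c. u \<noteq> v \<longrightarrow> K u v \<and> (u \<lhd> v \<or> v \<lhd> u)" using H(2,3) by blast
  ultimately show ?thesis by blast
qed

end

section \<open>The cardinality of the forcing notion\<close>

lemma omega1_lepoll: "(UNIV :: omega1 set) \<lesssim> (UNIV :: nat set set)"
proof -
  include cardinal_syntax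
  have "natLeq <o |UNIV :: nat set set|"
    using ordIso_ordLess_trans[OF ordIso_symmetric[OF card_of_nat] card_of_Pow] by simp
  then have "cardSuc natLeq \<le>o |UNIV :: nat set set|"
    using cardSuc_least natLeq_Card_order card_of_Card_order by blast
  moreover have "|Field (cardSuc natLeq)| =o cardSuc natLeq"
    by (rule card_of_Field_ordIso[OF cardSuc_Card_order[OF natLeq_Card_order]])
  moreover have "|UNIV :: omega1 set| \<le>o |Field (cardSuc natLeq)|"
    by (rule card_of_ordLeqI[of Rep_omega1]) (auto simp: inj_on_def Rep_omega1_inject intro: Rep_omega1)
  ultimately have "|UNIV :: omega1 set| \<le>o |UNIV :: nat set set|"
    using ordLeq_ordIso_trans ordLeq_transitive by blast
  then show ?thesis unfolding lepoll_def card_of_ordLeq .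
qed

lemma Times_lepoll_infinite:
  assumes "infinite C" "A \<lesssim> C" "B \<lesssim> C"
  shows "A \<times> B \<lesssim> C"
  using assms card_of_Times_ordLeq_infinite_Field[OF _ _ _ card_of_Card_order, of C A B]
  unfolding lepoll_def card_of_ordLeq by (simp add: Field_card_of)

lemma UNIV_set_lepoll_mono:
  assumes "(UNIV :: 'a set) \<lesssim> (UNIV :: 'b set)"
  shows "(UNIV :: 'a set set) \<lesssim> (UNIV :: 'b set set)"
proof -
  obtain f :: "'a \<Rightarrow> 'b" where "inj f" using assms unfolding lepoll_def by blast
  then have "inj ((`) f)" by (auto intro: injI simp: inj_image_eq_iff)
  then show ?thesis unfolding lepoll_def by blast
qed

text \<open>A list is coded by a set of pairs: \<open>(i, 0)\<close> marks the position
  \<open>i\<close> as present, and \<open>(i, Suc n)\<close> records that \<open>n\<close> belongs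
  to the code of the \<open>i\<close>-th entry.\<close>

lemma list_lepoll_nat_set:
  assumes "(UNIV :: 'a set) \<lesssim> (UNIV :: nat set set)"
  shows "(UNIV :: 'a list set) \<lesssim> (UNIV :: nat set set)"
proof -
  obtain f :: "'a \<Rightarrow> nat set" where f: "inj f" using assms unfolding lepoll_def by blast
  define g where "g xs = {(i, m). i < length xs \<and> (m = 0 \<or> m - 1 \<in> f (xs ! i))}" for xs
  have "inj g"
  proof (rule injI)
    fix xs ys assume eq: "g xs = g ys"
    have "i < length xs \<longleftrightarrow> (i, 0) \<in> g xs" "i < length ys \<longleftrightarrow> (i, 0) \<in> g ys" for i
      unfolding g_def by auto
    then have len: "length xs = length ys" using eq by (metis less_irrefl linorder_neqE_nat)
    have "xs ! i = ys ! i" if "i < length xs" for i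
    proof -
      have "n \<in> f (xs ! i) \<longleftrightarrow> (i, Suc n) \<in> g xs" "n \<in> f (ys ! i) \<longleftrightarrow> (i, Suc n) \<in> g ys" for n
        using that len unfolding g_def by auto
      then have "f (xs ! i) = f (ys ! i)" using eq by blast
      then show ?thesis using f by (simp add: inj_eq)
    qed
    then show "xs = ys" using len by (simp add: nth_equalityI)
  qed
  moreover have "inj (\<lambda>S. prod_encode ` S)"
    by (auto intro: injI simp: inj_image_eq_iff inj_prod_encode)
  ultimately have "inj ((\<lambda>S. prod_encode ` S) \<circ> g)" by (rule inj_compose[rotated])
  then show ?thesis unfolding lepoll_def by blast
qed

text \<open>The promises dominate: there are at most continuum many tuples of pairs of countable
  ordinals, and sets of sets of tuples require two further power sets.\<close>

lemma cond_lepoll: "(UNIV :: (omega1 \<times> omega1) cond set) \<lesssim> (UNIV :: nat set set set set)"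
proof -
  have inf: "infinite (UNIV :: nat set set)" "infinite (UNIV :: nat set set set set)"
    by (simp_all add: Finite_Set.finite_set)
  have point: "(UNIV :: (omega1 \<times> omega1) set) \<lesssim> (UNIV :: nat set set)"
    using Times_lepoll_infinite[OF inf(1) omega1_lepoll omega1_lepoll] by simp
  have "(UNIV :: nat set) \<lesssim> (UNIV :: nat set set)" using lepoll_Pow_self[of "UNIV :: nat set"] by simp
  then have color: "(UNIV :: ((omega1 \<times> omega1) \<times> nat) set) \<lesssim> (UNIV :: nat set set)"
    using Times_lepoll_infinite[OF inf(1) point, of "UNIV :: nat set"] by simp
  have up: "(UNIV :: nat set set set) \<lesssim> (UNIV :: nat set set set set)"
    using lepoll_Pow_self[of "UNIV :: nat set set set"] by simp
  have "(UNIV :: (omega1 \<times> omega1) set set) \<lesssim> (UNIV :: nat set set set set)"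
    "(UNIV :: ((omega1 \<times> omega1) \<times> nat) set set) \<lesssim> (UNIV :: nat set set set set)"
    using UNIV_set_lepoll_mono[OF point] UNIV_set_lepoll_mono[OF color] up lepoll_trans by blast+
  moreover have "(UNIV :: (omega1 \<times> omega1) list set set set) \<lesssim> (UNIV :: nat set set set set)"
    by (intro UNIV_set_lepoll_mono list_lepoll_nat_set point)
  ultimately have "(UNIV :: (omega1 \<times> omega1) set set) \<times> (UNIV :: (omega1 \<times> omega1) list set set set) \<times>
      (UNIV :: ((omega1 \<times> omega1) \<times> nat) set set) \<lesssim> (UNIV :: nat set set set set)"
    by (intro Times_lepoll_infinite inf(2))
  then show ?thesis by simp
qed

section \<open>Uncountable sets of countable ordinals\<close>

lemma countable_bounded_omega1:
  assumes "countable (S :: omega1 set)"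
  obtains a where "\<And>s. s \<in> S \<Longrightarrow> s < a"
proof -
  have "countable (\<Union>s\<in>S. {..<succ1 s})" using assms countable_omega1_lessThan by auto
  then obtain a where "a \<notin> (\<Union>s\<in>S. {..<succ1 s})" using uncountable_omega1 by (metis UNIV_eq_I)
  then have "s < a" if "s \<in> S" for s
    using that less_succ1[of s] by (meson UN_I lessThan_iff less_le_trans not_less)
  then show thesis by (rule that)
qed

lemma uncountable_omega1_unbounded:
  assumes "uncountable S"
  obtains s :: omega1 where "s \<in> S" "a < s"
proof -
  have "\<not> S \<subseteq> {..<succ1 a}"
    using assms countable_omega1_lessThan countable_subset by blast
  then obtain s where "s \<in> S" "\<not> s < succ1 a" by blast
  then show thesis using that[of s] succ1_le_iff by (simp add: not_less)
qed

text \<open>Luzin's argument: two members with equal \<open>A x - C\<close> and equal \<open>C \<inter> B x\<close> do not cross.\<close>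

lemma clique_not_separated:
  fixes A B :: "'a \<Rightarrow> nat set"
  assumes "uncountable H" and disj: "\<And>x. A x \<inter> B x = {}"
    and clique: "\<And>x y. x \<in> H \<Longrightarrow> y \<in> H \<Longrightarrow> x \<noteq> y \<Longrightarrow> A x \<inter> B y \<union> A y \<inter> B x \<noteq> {}"
    and sep: "\<And>x. x \<in> H \<Longrightarrow> finite (A x - C) \<and> finite (C \<inter> B x)"
  shows False
proof -
  have "(\<lambda>x. (A x - C, C \<inter> B x)) ` H \<subseteq> Fpow UNIV \<times> Fpow UNIV"
    using sep by (auto simp: Fpow_def)
  then have "countable ((\<lambda>x. (A x - C, C \<inter> B x)) ` H)"
    by (rule countable_subset) (intro countable_SIGMA countable_Fpow, auto)
  then have "\<not> inj_on (\<lambda>x. (A x - C, C \<inter> B x)) H"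
    using assms(1) countable_image_inj_on by blast
  then obtain x y where xy: "x \<in> H" "y \<in> H" "x \<noteq> y" "A x - C = A y - C" "C \<inter> B x = C \<inter> B y"
    unfolding inj_on_def by auto
  \<comment> \<open>A common element of \<open>A x\<close> and \<open>B y\<close> would lie in
    \<open>B x\<close> if it is in \<open>C\<close>, and in \<open>A y\<close> otherwise; both
    contradict \<open>disj\<close>.\<close>
  have "A x \<inter> B y = {}" "A y \<inter> B x = {}"
    using xy(4,5) disj[of x] disj[of y] by blast+
  then show False using clique[OF xy(1-3)] by simp
qed

section \<open>Pairs of levels of a gap\<close>

locale gap_pairs =
  fixes L R :: "omega1 \<Rightarrow> nat set"
  assumes gap: "omega1_gap L R"
begin

definition left :: "omega1 \<times> omega1 \<Rightarrow> nat set" where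
  "left x = L (snd x) - L (fst x) - R (snd x)"

definition right :: "omega1 \<times> omega1 \<Rightarrow> nat set" where
  "right x = R (snd x) - R (fst x)"

definition pairs :: "(omega1 \<times> omega1) set" where
  "pairs = {(\<alpha>, \<beta>). \<alpha> < \<beta>}"

text \<open>Membership in \<open>pairs\<close> is built in, so that transitivity and irreflexivity
  hold on the whole type, as the locale demands.\<close>

definition before :: "omega1 \<times> omega1 \<Rightarrow> omega1 \<times> omega1 \<Rightarrow> bool" where
  "before x y \<longleftrightarrow> x \<in> pairs \<and> y \<in> pairs \<and> snd x < fst y"

definition cross :: "omega1 \<times> omega1 \<Rightarrow> omega1 \<times> omega1 \<Rightarrow> bool" where
  "cross x y \<longleftrightarrow> left x \<inter> right y \<union> left y \<inter> right x \<noteq> {}"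

text \<open>This induces the topology of the Cantor space, a pair being identified with the
  characteristic functions of its two parts.\<close>

definition restrict :: "nat \<Rightarrow> omega1 \<times> omega1 \<Rightarrow> (bool \<times> bool) list" where
  "restrict k x = map (\<lambda>i. (i \<in> left x, i \<in> right x)) [0..<k]"

lemma finite_inter: "finite (L \<alpha> \<inter> R \<beta>)"
  using gap unfolding omega1_gap_def gap_def pregap_def by blast

lemma almost_mono: "\<alpha> \<le> \<beta> \<Longrightarrow> finite (L \<alpha> - L \<beta>)" "\<alpha> \<le> \<beta> \<Longrightarrow> finite (R \<alpha> - R \<beta>)"
  using gap unfolding omega1_gap_def almost_increasing_def almost_subset_def
  by (cases "\<alpha> = \<beta>"; auto simp: order.order_iff_strict)+

lemma not_separated: "\<not> separates C (range L) (range R)"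
  using gap unfolding omega1_gap_def gap_def by blast

lemma restrict_eqD:
  assumes "restrict k x = restrict k y" "i < k"
  shows "i \<in> left x \<longleftrightarrow> i \<in> left y" "i \<in> right x \<longleftrightarrow> i \<in> right y"
  using assms unfolding restrict_def by auto

text \<open>Otherwise uncountably many pairs with the same first component lie in one set without
  crossings, and the union of their left parts separates the gap.\<close>

lemma pairs_rich:
  assumes "countable Y" "Y \<subseteq> pairs" "countable \<H>"
    and free: "\<And>H x y. H \<in> \<H> \<Longrightarrow> x \<in> H \<Longrightarrow> y \<in> H \<Longrightarrow> \<not> cross x y"
  shows "\<exists>x\<in>pairs. (\<forall>y\<in>Y. before y x) \<and> x \<notin> \<Union>\<H>"
proof (rule ccontr)
  assume no: "\<not> ?thesis"
  have "countable (snd ` Y)" using assms(1) by simp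
  then obtain \<alpha> where \<alpha>: "\<And>y. y \<in> Y \<Longrightarrow> snd y < \<alpha>"
    by (rule countable_bounded_omega1) auto
  have covered: "(\<alpha>, \<beta>) \<in> \<Union>\<H>" if "\<alpha> < \<beta>" for \<beta>
  proof -
    have "(\<alpha>, \<beta>) \<in> pairs" using that unfolding pairs_def by simp
    moreover have "\<forall>y\<in>Y. before y (\<alpha>, \<beta>)"
      using \<alpha> assms(2) calculation unfolding before_def by auto
    ultimately show ?thesis using no by blast
  qed
  have "\<exists>H\<in>\<H>. uncountable {\<beta>. \<alpha> < \<beta> \<and> (\<alpha>, \<beta>) \<in> H}"
  proof (rule ccontr)
    assume "\<not> ?thesis"
    then have "countable ({..<succ1 \<alpha>} \<union> (\<Union>H\<in>\<H>. {\<beta>. \<alpha> < \<beta> \<and> (\<alpha>, \<beta>) \<in> H}))"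
      using assms(3) countable_omega1_lessThan by auto
    moreover have "\<dots> = UNIV"
    proof -
      have "\<beta> < succ1 \<alpha> \<or> \<alpha> < \<beta>" for \<beta>
        using less_succ1[of \<alpha>] by (metis le_less_trans not_less)
      then show ?thesis using covered by fastforce
    qed
    ultimately show False using uncountable_omega1 by simp
  qed
  then obtain H where H: "H \<in> \<H>" and "uncountable {\<beta>. \<alpha> < \<beta> \<and> (\<alpha>, \<beta>) \<in> H}" by blast
  define T where "T = {\<beta>. \<alpha> < \<beta> \<and> (\<alpha>, \<beta>) \<in> H}"
  have T: "uncountable T" unfolding T_def by fact
  have uncrossed: "left (\<alpha>, \<beta>) \<inter> right (\<alpha>, \<beta>') = {}" if "\<beta> \<in> T" "\<beta>' \<in> T" for \<beta> \<beta>'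
    using free[OF H, of "(\<alpha>, \<beta>)" "(\<alpha>, \<beta>')"] that unfolding T_def cross_def by auto
  \<comment> \<open>\<open>L \<alpha>\<close> is added because the left parts omit it.
    \<open>R \<alpha>\<close> is removed so that an element of \<open>C\<close> in
    \<open>R \<beta>\<close> lies in the right part of \<open>(\<alpha>, \<beta>)\<close>, where
    \<open>uncrossed\<close> applies.\<close>
  define C where "C = ((\<Union>\<beta>\<in>T. left (\<alpha>, \<beta>)) \<union> L \<alpha>) - R \<alpha>"
  have "finite (L \<gamma> - C) \<and> finite (C \<inter> R \<gamma>)" for \<gamma>
  proof -
    obtain \<beta> where \<beta>: "\<beta> \<in> T" "\<gamma> < \<beta>" using uncountable_omega1_unbounded[OF T] by blast
    have "L \<gamma> - C \<subseteq> (L \<gamma> - L \<beta>) \<union> (L \<beta> \<inter> R \<beta>) \<union> (L \<beta> \<inter> R \<alpha>)"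
      using \<beta>(1) unfolding C_def left_def by auto
    moreover have "C \<inter> R \<gamma> \<subseteq> (R \<gamma> - R \<beta>) \<union> (L \<alpha> \<inter> R \<beta>)"
    proof
      fix i assume i: "i \<in> C \<inter> R \<gamma>"
      have "i \<in> L \<alpha>" if "i \<in> R \<beta>"
      proof (rule ccontr)
        assume "i \<notin> L \<alpha>"
        then obtain \<beta>' where "\<beta>' \<in> T" "i \<in> left (\<alpha>, \<beta>')" using i unfolding C_def by blast
        moreover have "i \<in> right (\<alpha>, \<beta>)" using i that unfolding C_def right_def by simp
        ultimately show False using uncrossed \<beta>(1) by blast
      qed
      then show "i \<in> (R \<gamma> - R \<beta>) \<union> (L \<alpha> \<inter> R \<beta>)" using i by blast
    qed
    ultimately show ?thesis
      using almost_mono \<beta>(2) finite_inter by (meson finite_Un finite_subset less_imp_le)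
  qed
  then have "separates C (range L) (range R)" unfolding separates_def by blast
  then show False using not_separated by blast
qed

sublocale rich_open_graph pairs before cross restrict
proof
  show "before x z" if "before x y" "before y z" for x y z
    using that unfolding before_def pairs_def by auto
  show "\<not> before x x" for x unfolding before_def pairs_def by auto
  show "cross y x" if "cross x y" for x y using that unfolding cross_def by blast
  show "restrict k x = restrict k y" if "k \<le> l" "restrict l x = restrict l y" for k l x y
    using restrict_eqD[OF that(2)] that(1) unfolding restrict_def by auto
  show "\<exists>k. \<forall>x' y'. restrict k x' = restrict k x \<longrightarrow> restrict k y' = restrict k y \<longrightarrow> cross x' y'"
    if xy: "cross x y" for x y
  proof -
    obtain i where "i \<in> left x \<inter> right y \<union> left y \<inter> right x" using xy unfolding cross_def by blast
    then show ?thesis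
      \<comment> \<open>\<open>restrict k\<close> decides the numbers below \<open>k\<close>, so
        \<open>Suc i\<close> is the first value that sees \<open>i\<close>.\<close>
      unfolding cross_def using restrict_eqD[of "Suc i"] by (intro exI[of _ "Suc i"]) blast
  qed
qed (rule pairs_rich)

text \<open>
  Weakly monotone reindexing suffices: \<open>g \<xi>\<close> is the least relevant index above \<open>\<xi>\<close>, and since no relevant
  index lies strictly between the components of \<open>(\<alpha>, \<beta>) \<in> H\<close>, it sends \<open>\<alpha>\<close> and \<open>succ1 \<alpha>\<close> to \<open>\<alpha>\<close> and \<open>\<beta>\<close>.
\<close>

lemma clique_imp_weakly_levelwise_inseparable:
  assumes H: "H \<subseteq> pairs" and unbounded: "\<And>\<xi>. \<exists>x\<in>H. \<xi> < fst x"
    and clique: "\<And>x y. x \<in> H \<Longrightarrow> y \<in> H \<Longrightarrow> x \<noteq> y \<Longrightarrow> cross x y \<and> (before x y \<or> before y x)"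
  shows "weakly_levelwise_inseparable L R"
proof -
  define E where "E = fst ` H \<union> snd ` H"
  define g where "g \<xi> = (LEAST e. e \<in> E \<and> \<xi> \<le> e)" for \<xi>
  have g: "g \<xi> \<in> E \<and> \<xi> \<le> g \<xi>" for \<xi>
  proof -
    obtain x where "x \<in> H" "\<xi> < fst x" using unbounded by blast
    then have "fst x \<in> E \<and> \<xi> \<le> fst x" unfolding E_def by auto
    then show ?thesis unfolding g_def by (rule LeastI)
  qed
  have g_le: "g \<xi> \<le> e" if "e \<in> E" "\<xi> \<le> e" for \<xi> e
    unfolding g_def using that by (intro Least_le) simp
  have g_mono: "g \<xi> \<le> g \<eta>" if "\<xi> \<le> \<eta>" for \<xi> \<eta>
    using g[of \<eta>] that by (intro g_le) auto
  have g_fst: "g (fst x) = fst x" and g_snd: "g (succ1 (fst x)) = snd x" if x: "x \<in> H" for x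
  proof -
    show "g (fst x) = fst x"
      using g[of "fst x"] g_le[of "fst x" "fst x"] x unfolding E_def by auto
    have "fst x < snd x" using x H unfolding pairs_def by auto
    then have "g (succ1 (fst x)) \<le> snd x"
      using x by (intro g_le) (auto simp: E_def succ1_le_iff)
    \<comment> \<open>Any other member of \<open>H\<close> lies entirely before or entirely after
      \<open>x\<close>, and \<open>fst x < e\<close> excludes the former.\<close>
    moreover have "snd x \<le> e" if e: "e \<in> E" "fst x < e" for e
    proof -
      obtain y where y: "y \<in> H" "e = fst y \<or> e = snd y" using e(1) unfolding E_def by auto
      then have "fst y < snd y" using H unfolding pairs_def by auto
      show ?thesis
      proof (cases "y = x")
        case False
        then show ?thesis
          using clique[OF y(1) x] y(2) e(2) \<open>fst y < snd y\<close> unfolding before_def by auto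
      qed (use y(2) e(2) in auto)
    qed
    ultimately show "g (succ1 (fst x)) = snd x"
      using g[of "succ1 (fst x)"] succ1_le_iff by (meson order.antisym)
  qed
  define L' where "L' \<xi> = L (g \<xi>)" for \<xi>
  define R' where "R' \<xi> = R (g \<xi>)" for \<xi>
  \<comment> \<open>Since \<open>g \<xi>\<close> is at least \<open>\<xi>\<close>, the reindexed
    sequences are cofinal in the given ones, and a separator of the former separates the
    latter.\<close>
  have "\<not> separates C (range L') (range R')" for C
  proof
    assume sep: "separates C (range L') (range R')"
    have "finite (L \<xi> - C) \<and> finite (C \<inter> R \<xi>)" for \<xi>
    proof -
      have "finite (L (g \<xi>) - C)" "finite (C \<inter> R (g \<xi>))"
        using sep unfolding separates_def L'_def R'_def by blast+
      moreover have "L \<xi> - C \<subseteq> (L \<xi> - L (g \<xi>)) \<union> (L (g \<xi>) - C)"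
        "C \<inter> R \<xi> \<subseteq> (R \<xi> - R (g \<xi>)) \<union> (C \<inter> R (g \<xi>))" by auto
      ultimately show ?thesis using almost_mono[of \<xi> "g \<xi>"] g by (meson finite_Un finite_subset)
    qed
    then show False using not_separated[of C] unfolding separates_def by blast
  qed
  moreover have "pregap (range L') (range R')"
    unfolding pregap_def L'_def R'_def using finite_inter by blast
  moreover have "almost_increasing L'" "almost_increasing R'"
    unfolding almost_increasing_def almost_subset_def L'_def R'_def
    using almost_mono g_mono by (meson less_imp_le)+
  ultimately have "subgap L' R' L R"
    unfolding subgap_def omega1_gap_def gap_def by (auto simp: L'_def R'_def)
  moreover have "levelwise_inseparable L' R'"
    unfolding levelwise_inseparable_def gap_def
  proof (intro conjI notI)
    show "pregap (range (\<lambda>\<xi>. L' (succ1 \<xi>) - L' \<xi>)) (range (\<lambda>\<xi>. R' (succ1 \<xi>) - R' \<xi>))"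
      unfolding pregap_def L'_def R'_def
      by (auto intro!: finite_subset[OF _ finite_inter])
    assume "\<exists>C. separates C (range (\<lambda>\<xi>. L' (succ1 \<xi>) - L' \<xi>)) (range (\<lambda>\<xi>. R' (succ1 \<xi>) - R' \<xi>))"
    then obtain C where C: "\<And>\<xi>. finite (L' (succ1 \<xi>) - L' \<xi> - C) \<and> finite (C \<inter> (R' (succ1 \<xi>) - R' \<xi>))"
      unfolding separates_def by blast
    show False
    proof (rule clique_not_separated[of H left right C])
      show "uncountable H"
      proof
        assume "countable H"
        then have "countable (fst ` H)" by simp
        then obtain a where "\<And>x. x \<in> H \<Longrightarrow> fst x < a" by (rule countable_bounded_omega1) auto
        then show False using unbounded[of a] by (meson less_asym)
      qed
      show "left x \<inter> right x = {}" for x unfolding left_def right_def by auto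
      show "left x \<inter> right y \<union> left y \<inter> right x \<noteq> {}" if "x \<in> H" "y \<in> H" "x \<noteq> y" for x y
        using clique[OF that] unfolding cross_def by blast
      show "finite (left x - C) \<and> finite (C \<inter> right x)" if x: "x \<in> H" for x
      proof
        have "left x - C \<subseteq> L' (succ1 (fst x)) - L' (fst x) - C"
          unfolding left_def L'_def g_fst[OF x] g_snd[OF x] by auto
        then show "finite (left x - C)" using C finite_subset by blast
        show "finite (C \<inter> right x)"
          using C[of "fst x"] unfolding right_def R'_def g_fst[OF x] g_snd[OF x] by simp
      qed
    qed
  qed
  ultimately show ?thesis unfolding weakly_levelwise_inseparable_def by blast
qed

end

theorem mainTheorem3:
  fixes L R :: "omega1 \<Rightarrow> nat set"
  assumes "(UNIV :: nat set set set set) \<lesssim> (UNIV :: 'u set)"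
    and "PFA TYPE('u)"
    and "omega1_gap L R"
  shows "weakly_levelwise_inseparable L R"
proof -
  interpret gap_pairs L R by unfold_locales fact
  \<comment> \<open>The size of \<open>'u\<close> leaves room for all conditions, so the axiom
    passes to their type.\<close>
  obtain h :: "(omega1 \<times> omega1) cond \<Rightarrow> 'u" where "inj h"
    using lepoll_trans[OF cond_lepoll assms(1)] unfolding lepoll_def by blast
  then have "PFA TYPE((omega1 \<times> omega1) cond)" using assms(2) by (rule PFA_inj)
  \<comment> \<open>With these pairs as the points \<open>y \<alpha>\<close>, a member of
    \<open>H\<close> after \<open>y \<alpha>\<close> has its first component above
    \<open>\<alpha>\<close>.\<close>
  moreover have "(\<alpha>, succ1 \<alpha>) \<in> pairs" for \<alpha> unfolding pairs_def using less_succ1 by simp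
  ultimately have "\<exists>H\<subseteq>pairs. (\<forall>u\<in>H. \<forall>v\<in>H. u \<noteq> v \<longrightarrow> cross u v \<and> (before u v \<or> before v u)) \<and>
      uncountable {\<alpha>. \<exists>x\<in>H. before (\<alpha>, succ1 \<alpha>) x}"
    by (rule uncountable_clique)
  then obtain H where H: "H \<subseteq> pairs"
      "\<forall>u\<in>H. \<forall>v\<in>H. u \<noteq> v \<longrightarrow> cross u v \<and> (before u v \<or> before v u)"
      "uncountable {\<alpha>. \<exists>x\<in>H. before (\<alpha>, succ1 \<alpha>) x}" by (elim exE conjE)
  have "\<exists>x\<in>H. \<xi> < fst x" for \<xi>
  proof -
    obtain \<alpha> x where "\<xi> < \<alpha>" "x \<in> H" "before (\<alpha>, succ1 \<alpha>) x"
      using uncountable_omega1_unbounded[OF H(3)] by blast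
    then show ?thesis
      using less_succ1[of \<alpha>] unfolding before_def by (intro bexI[of _ x]) auto
  qed
  then show ?thesis using H by (intro clique_imp_weakly_levelwise_inseparable[of H]) auto
qed

end
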